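(* Suppose that $f:\mathbb{R}^n\to\overline{\mathbb{R}}$ is finite and locally lsc at $\bar x$. Let $0\le\theta<1$ and $g(x):=(\max\{f(x)-f(\bar x),0\})^{1-\theta}$. Define $h:\mathbb{R}^n\to\overline{\mathbb{R}}$ by $$h(w):=\liminf_{\tau\to0+,\ w'\to w}\frac{f(\bar x+\tau w')-f(\bar x)}{(1-\theta)\,\tau^{\frac1{1-\theta}}},$$ and let $W:=\{w\in\mathbb{R}^n\mid 0<h(w)<+\infty\}$. Let $h_+:=\max\{h,0\}$. The following hold: (a) $h$ is lsc and positively homogeneous of degree $\frac1{1-\theta}$, with $h(w)=\langle v,w\rangle$ for all $v\in\partial[(1-\theta)h](w)$. Moreover, either $h(0)=0$ or $h(0)=-\infty$, and $h$ is proper if and only if $h(0)=0$. (b) The outer limiting subdifferential set $\partial^{>}g(\bar x)$ has $$\bigcup_{w\in W}\frac{(1-\theta)\,\partial[(1-\theta)h](w)}{[(1-\theta)h(w)]^{\theta}}$$ as a subset (possibly not closed), which consists of nonzero vectors, and is nonempty if and only if $W\neq\emptyset$. Moreover, $$\partial^{>}[dg(\bar x)](0)=\operatorname{cl}\bigcup_{w\in W}\frac{(1-\theta)\,\partial[(1-\theta)h](w)}{[(1-\theta)h(w)]^{\theta}}.$$ (c) If $W\neq\emptyset$, then $f$ cannot satisfy the KL property at $\bar x$ with any exponent $\theta'\in[0,\theta)$. (d) Let $\mu>0$. If $f$ satisfies the KL property at $\bar x$ with exponent $\theta$ and modulus $\mu$, then $$d\left(0,\partial[(1-\theta)h](w)\right)\ge\frac{\mu}{1-\theta}[(1-\theta)h(w)]^{\theta}\quad\text{for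 all } w\in W.$$ (e) If $h$ is proper, then $\mathrm{KL}(f,\bar x,\theta)\le\mathrm{KL}((1-\theta)h,0,\theta)$. Otherwise, $\mathrm{KL}(f,\bar x,\theta)\le\mathrm{KL}((1-\theta)h_+,0,\theta)$.
   Context: $\overline{\mathbb{R}}=\mathbb{R}\cup\{\pm\infty\}$. $d(v,A)=\inf_{a\in A}\|a-v\|$, with $d(v,\emptyset)=+\infty$. A function is proper if it never takes the value $-\infty$ and is not identically $+\infty$; it is positively homogeneous of degree $\gamma>0$ if $h(\lambda w)=\lambda^{\gamma}h(w)$ for all $\lambda>0$ and all $w$ with $h(w)<+\infty$. A function $\varphi:\mathbb{R}^n\to\overline{\mathbb{R}}$ that is finite at $\bar x$ is locally lsc at $\bar x$ if $\operatorname{epi}\varphi$ is locally closed at $(\bar x,\varphi(\bar x))$. Subderivative: for $\varphi$ finite at $\bar x$, $d\varphi(\bar x)(w):=\liminf_{t\downarrow0,\ w'\to w}\frac{\varphi(\bar x+tw')-\varphi(\bar x)}{t}$. Subgradients. Let $\varphi(x)$ be finite. $v\in\widehat\partial\varphi(x)$ if $\varphi(y)\ge\varphi(x)+\langle v,y-x\rangle+o(\|y-x\|)$. $v\in\partial\varphi(x)$ (limiting) if there are $x_k\to x$, $v_k\to v$ with $\varphi(x_k)\to\varphi(x)$ and $v_k\in\widehat\partial\varphi(x_k)$. $v\in\partial^{>}\varphi(x)$ (outer limiting) if there are $x_k\to x$, $v_k\to v$ with $\varphi(x_k)\to\varphi(x)$, $\varphi(x_k)>\varphi(x)$ and $v_k\in\partial\varphi(x_k)$.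 Subdifferentials are empty at points where $\varphi$ is not finite. KL property. Let $\varphi$ be finite and locally lsc at $\bar x$. It satisfies the KL property at $\bar x$ with exponent $\theta\in[0,1)$ and modulus $\mu>0$ if there exist $\epsilon>0$ and $\nu\in(0,+\infty]$ such that $d(0,\partial\varphi(x))\ge\frac{\mu}{1-\theta}(\max\{\varphi(x)-\varphi(\bar x),0\})^{\theta}$ whenever $\|x-\bar x\|\le\epsilon$ and $\varphi(x)<\varphi(\bar x)+\nu$ (with $0^0:=0$, so only points with $\varphi(x)>\varphi(\bar x)$ matter). "With exponent $\theta$" means for some modulus $\mu>0$. $\mathrm{KL}(\varphi,\bar x,\theta)$ is the supremum of all such $\mu$ ($\sup\emptyset:=0$); equivalently $\mathrm{KL}(\varphi,\bar x,\theta)=\liminf\frac{(1-\theta)d(0,\partial\varphi(x))}{(\varphi(x)-\varphi(\bar x))^{\theta}}$ as $x\to\bar x$, $\varphi(x)\to\varphi(\bar x)$, $\varphi(x)>\varphi(\bar x)$, set to $+\infty$ if no such sequences exist. *)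

theory Defs
  imports "HOL-Analysis.Analysis" "HOL-Library.Landau_Symbols"
begin

(* d(v, A); the infimum over the empty set is infinity, unlike for infdist. *)
definition edist_set :: "'a::real_normed_vector \<Rightarrow> 'a set \<Rightarrow> ereal" where
  "edist_set v A = (INF a\<in>A. ereal (norm (a - v)))"

(* Powers of extended reals in [0, infinity]. Note 0 powr p = 0 for every p, so 0^0 = 0.
   The value at infinity is the usual one for p > 0, the only case where it is used. *)
definition epowr :: "ereal \<Rightarrow> real \<Rightarrow> ereal" where
  "epowr a p = (if a = \<infinity> then \<infinity> else ereal (real_of_ereal a powr p))"

definition finite_at :: "('a \<Rightarrow> ereal) \<Rightarrow> 'a \<Rightarrow> bool" where
  "finite_at \<phi> x \<longleftrightarrow> \<bar>\<phi> x\<bar> \<noteq> \<infinity>"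

definition proper_fun :: "('a \<Rightarrow> ereal) \<Rightarrow> bool" where
  "proper_fun \<phi> \<longleftrightarrow> (\<forall>x. \<phi> x \<noteq> -\<infinity>) \<and> (\<exists>x. \<phi> x \<noteq> \<infinity>)"

definition pos_homogeneous :: "real \<Rightarrow> ('a::real_vector \<Rightarrow> ereal) \<Rightarrow> bool" where
  "pos_homogeneous \<gamma> \<phi> \<longleftrightarrow>
     (\<forall>l>0. \<forall>w. \<phi> w < \<infinity> \<longrightarrow> \<phi> (l *\<^sub>R w) = ereal (l powr \<gamma>) * \<phi> w)"

definition lsc :: "('a::topological_space \<Rightarrow> ereal) \<Rightarrow> bool" where
  "lsc \<phi> \<longleftrightarrow> (\<forall>x. \<phi> x \<le> Liminf (nhds x) \<phi>)"

definition epi :: "('a \<Rightarrow> ereal) \<Rightarrow> ('a \<times> real) set" where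
  "epi \<phi> = {(x, \<alpha>). \<phi> x \<le> ereal \<alpha>}"

definition locally_closed_at :: "'a::topological_space set \<Rightarrow> 'a \<Rightarrow> bool" where
  "locally_closed_at E p \<longleftrightarrow> (\<exists>V. closed V \<and> p \<in> interior V \<and> closed (E \<inter> V))"

definition locally_lsc_at :: "('a::topological_space \<Rightarrow> ereal) \<Rightarrow> 'a \<Rightarrow> bool" where
  "locally_lsc_at \<phi> x \<longleftrightarrow> locally_closed_at (epi \<phi>) (x, real_of_ereal (\<phi> x))"

definition subderivative ::
  "('a::real_normed_vector \<Rightarrow> ereal) \<Rightarrow> 'a \<Rightarrow> 'a \<Rightarrow> ereal" where
  "subderivative \<phi> x w =
     Liminf (at_right (0::real) \<times>\<^sub>F nhds w)
       (\<lambda>(t, w'). (\<phi> (x + t *\<^sub>R w') - \<phi> x) / ereal t)"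

definition frechet_subdiff :: "('a::euclidean_space \<Rightarrow> ereal) \<Rightarrow> 'a \<Rightarrow> 'a set" where
  "frechet_subdiff \<phi> x = {v. finite_at \<phi> x \<and>
     (\<exists>r :: 'a \<Rightarrow> real. r \<in> o[at x](\<lambda>y. norm (y - x)) \<and>
        (\<forall>\<^sub>F y in at x. \<phi> y \<ge> \<phi> x + ereal (v \<bullet> (y - x) + r y)))}"

definition limiting_subdiff :: "('a::euclidean_space \<Rightarrow> ereal) \<Rightarrow> 'a \<Rightarrow> 'a set" where
  "limiting_subdiff \<phi> x = {v. finite_at \<phi> x \<and>
     (\<exists>(xs :: nat \<Rightarrow> 'a) vs. xs \<longlonglongrightarrow> x \<and> vs \<longlonglongrightarrow> v \<and> (\<lambda>k. \<phi> (xs k)) \<longlonglongrightarrow> \<phi> x \<and>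
        (\<forall>k. vs k \<in> frechet_subdiff \<phi> (xs k)))}"

definition outer_limiting_subdiff :: "('a::euclidean_space \<Rightarrow> ereal) \<Rightarrow> 'a \<Rightarrow> 'a set" where
  "outer_limiting_subdiff \<phi> x = {v. finite_at \<phi> x \<and>
     (\<exists>(xs :: nat \<Rightarrow> 'a) vs. xs \<longlonglongrightarrow> x \<and> vs \<longlonglongrightarrow> v \<and> (\<lambda>k. \<phi> (xs k)) \<longlonglongrightarrow> \<phi> x \<and>
        (\<forall>k. \<phi> (xs k) > \<phi> x \<and> vs k \<in> limiting_subdiff \<phi> (xs k)))}"

(* The standing conditions (finite and locally lsc at x0, theta in [0,1), mu > 0) are part
   of the predicate. *)
definition KL_property ::
  "('a::euclidean_space \<Rightarrow> ereal) \<Rightarrow> 'a \<Rightarrow> real \<Rightarrow> real \<Rightarrow> bool" where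
  "KL_property \<phi> x0 \<theta> \<mu> \<longleftrightarrow>
     finite_at \<phi> x0 \<and> locally_lsc_at \<phi> x0 \<and> 0 \<le> \<theta> \<and> \<theta> < 1 \<and> 0 < \<mu> \<and>
     (\<exists>\<epsilon>::real. \<exists>\<nu>::ereal. \<epsilon> > 0 \<and> \<nu> > 0 \<and>
        (\<forall>x. norm (x - x0) \<le> \<epsilon> \<and> \<phi> x < \<phi> x0 + \<nu> \<longrightarrow>
           edist_set 0 (limiting_subdiff \<phi> x) \<ge>
             ereal (\<mu> / (1 - \<theta>)) * epowr (max (\<phi> x - \<phi> x0) 0) \<theta>))"

definition KL_exponent :: "('a::euclidean_space \<Rightarrow> ereal) \<Rightarrow> 'a \<Rightarrow> real \<Rightarrow> bool" where
  "KL_exponent \<phi> x0 \<theta> \<longleftrightarrow> (\<exists>\<mu>. KL_property \<phi> x0 \<theta> \<mu>)"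

(* Inserting 0 encodes the convention that the supremum of the empty set is 0
   (in ereal it would be -infinity). *)
definition KL_modulus :: "('a::euclidean_space \<Rightarrow> ereal) \<Rightarrow> 'a \<Rightarrow> real \<Rightarrow> ereal" where
  "KL_modulus \<phi> x0 \<theta> = Sup (insert 0 (ereal ` {\<mu>. KL_property \<phi> x0 \<theta> \<mu>}))"

end

theory Submission
  imports Defs
begin

text \<open>Write \<open>p = 1 / (1 - \<theta>)\<close> and \<open>H = (1 - \<theta>) h\<close>. Then \<open>H\<close> is the lower epi-limit, as
\<open>t\<close> decreases to \<open>0\<close>, of the blow-ups \<open>(f (xbar + t w) - f xbar) / t^p\<close>. Lower epi-limits are lsc, and
rescaling \<open>t\<close> shows that \<open>H\<close> is homogeneous of degree \<open>p\<close>. As all blow-ups vanish at \<open>0\<close>, only \<open>0\<close>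
and \<open>-\<infinity>\<close> are left for \<open>H 0\<close>, and a value \<open>-\<infinity>\<close> anywhere spreads along a ray to the origin.
Differentiating along rays turns homogeneity into Euler's identity \<open>v \<bullet> w = p H w = h w\<close> for subgradients \<open>v\<close> of \<open>H\<close> at \<open>w\<close>,
first for Frechet and then for limiting subgradients. This is part (a).

The engine of the other parts is the fact that subgradients of a lower epi-limit are limits of
Frechet subgradients of the approximating functions, at nearby points with nearby values
(\<open>limiting_subdiff_epi_liminf_approx\<close>). It follows from penalization: if
\<open>v\<close> is a Frechet subgradient of the limit at \<open>w\<close>, then \<open>y \<mapsto> H y - v \<bullet> (y - w) + K |y - w|^2\<close>
is larger on a small sphere around \<open>w\<close> than at \<open>w\<close>. By compactness the same holds with \<open>H\<close> replaced
by an approximating function, which therefore, once penalized, has an interior minimizer on the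
ball, and there the gradient of the smooth penalty produces a Frechet subgradient close to \<open>v\<close>.
Undoing the scaling in the blow-ups (\<open>blowup_subgradient_sequence\<close>) yields, for each \<open>v\<close> in
\<open>\<partial>H(w)\<close> with \<open>H w\<close> finite, points \<open>x_k\<close> tending to \<open>xbar\<close>, positive numbers \<open>t_k\<close> tending to \<open>0\<close>,
values \<open>f x_k = f xbar + t_k^p a_k\<close> with \<open>a_k\<close> tending to \<open>H w\<close>, and Frechet subgradients
\<open>t_k^(p - 1) v_k\<close> of \<open>f\<close> at \<open>x_k\<close> with \<open>v_k\<close> tending to \<open>v\<close>.

For (b), the chain rule for the increasing map \<open>s \<mapsto> s^(1 - \<theta>)\<close> on positive values turns
these into subgradients of \<open>g\<close>, and the powers of \<open>t_k\<close> cancel. The same chain rule, used with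
that map and with its inverse, identifies the union \<open>U\<close> with the union of the sets
\<open>\<partial>G(w)\<close> over \<open>0 < G w < \<infinity>\<close>, where \<open>G = max H 0 powr (1 - \<theta>)\<close> is the subderivative of \<open>g\<close>. Since
\<open>G\<close> is homogeneous of degree one, \<open>\<partial>G\<close> is constant along rays, so that every such subgradient
occurs arbitrarily close to the origin; this gives the formula with the closure. Penalizing \<open>H\<close>
itself shows that a nonempty \<open>W\<close> contains a point where \<open>H\<close> has a subgradient.

For (c) and (d), insert the sequence into the KL inequality with exponent \<open>\<theta>'\<close> and divide by
\<open>t_k^(p \<theta>')\<close>: the factor \<open>t_k^(p - 1 - p \<theta>')\<close> remains in front of \<open>norm v_k\<close>, with exponent
\<open>p (\<theta> - \<theta>')\<close>. If \<open>\<theta>' < \<theta>\<close>, it tends to \<open>0\<close>, which is absurd; if \<open>\<theta>' = \<theta>\<close>, it is \<open>1\<close>, and the limit is the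
bound of (d). That bound is, if \<open>H 0 = 0\<close>, the KL inequality for \<open>H\<close> at \<open>0\<close> on the whole space, and in any
case the one for \<open>max H 0\<close>, because the two functions agree near every point where \<open>H\<close> is positive. Hence (e).\<close>

section \<open>Frechet subgradients\<close>

text \<open>The little-o remainder of the definition becomes one inequality for each slope \<open>\<epsilon>\<close>. It is
stated on a full neighbourhood, since it is trivial at \<open>x\<close> itself, so that it can be composed
with maps that hit \<open>x\<close>.\<close>

lemma frechet_subdiff_iff:
  fixes \<phi> :: "'a::euclidean_space \<Rightarrow> ereal"
  assumes "\<phi> x = ereal a"
  shows "v \<in> frechet_subdiff \<phi> x \<longleftrightarrow>
    (\<forall>\<epsilon>>0. \<forall>\<^sub>F y in nhds x. ereal (a + v \<bullet> (y - x) - \<epsilon> * norm (y - x)) \<le> \<phi> y)"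
proof
  assume "v \<in> frechet_subdiff \<phi> x"
  then obtain r where r: "r \<in> o[at x](\<lambda>y. norm (y - x))"
    and ev: "\<forall>\<^sub>F y in at x. \<phi> y \<ge> \<phi> x + ereal (v \<bullet> (y - x) + r y)"
    by (auto simp: frechet_subdiff_def)
  show "\<forall>\<epsilon>>0. \<forall>\<^sub>F y in nhds x. ereal (a + v \<bullet> (y - x) - \<epsilon> * norm (y - x)) \<le> \<phi> y"
  proof (intro allI impI)
    fix \<epsilon> :: real assume "\<epsilon> > 0"
    from landau_o.smallD[OF r this] ev
    have "\<forall>\<^sub>F y in at x. ereal (a + v \<bullet> (y - x) - \<epsilon> * norm (y - x)) \<le> \<phi> y"
    proof eventually_elim
      case (elim y)
      have "ereal (a + v \<bullet> (y - x) - \<epsilon> * norm (y - x)) \<le> \<phi> x + ereal (v \<bullet> (y - x) + r y)"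
        using elim(1) assms by simp
      also note elim(2)
      finally show ?case .
    qed
    then show "\<forall>\<^sub>F y in nhds x. ereal (a + v \<bullet> (y - x) - \<epsilon> * norm (y - x)) \<le> \<phi> y"
      unfolding eventually_at_filter by eventually_elim (use assms in auto)
  qed
next
  assume H: "\<forall>\<epsilon>>0. \<forall>\<^sub>F y in nhds x. ereal (a + v \<bullet> (y - x) - \<epsilon> * norm (y - x)) \<le> \<phi> y"
  \<comment> \<open>The remainder nearest to zero that makes the inequality true. Where \<open>\<phi>\<close> is infinite every
    remainder does, and \<open>0\<close> keeps it little-o.\<close>
  define r where "r y = (if \<phi> y = \<infinity> then 0
      else min 0 (real_of_ereal (\<phi> y) - a - v \<bullet> (y - x)))" for y
  have "r \<in> o[at x](\<lambda>y. norm (y - x))"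
  proof (rule landau_o.smallI)
    fix c :: real assume "c > 0"
    then have "\<forall>\<^sub>F y in at x. ereal (a + v \<bullet> (y - x) - c * norm (y - x)) \<le> \<phi> y"
      using H by (auto simp: eventually_at_filter elim: eventually_mono)
    then show "\<forall>\<^sub>F y in at x. norm (r y) \<le> c * norm (norm (y - x))"
    proof eventually_elim
      case (elim y)
      then show ?case using \<open>c > 0\<close>
        by (cases "\<phi> y") (auto simp: r_def min_def)
    qed
  qed
  moreover have "\<forall>\<^sub>F y in at x. \<phi> y \<ge> \<phi> x + ereal (v \<bullet> (y - x) + r y)"
  proof -
    have "\<forall>\<^sub>F y in at x. ereal (a + v \<bullet> (y - x) - 1 * norm (y - x)) \<le> \<phi> y"
      using H[rule_format, of 1] by (auto simp: eventually_at_filter elim: eventually_mono)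
    then show ?thesis
    proof eventually_elim
      case (elim y)
      then show ?case using assms
        by (cases "\<phi> y") (auto simp: r_def min_def)
    qed
  qed
  ultimately show "v \<in> frechet_subdiff \<phi> x"
    using assms by (auto simp: frechet_subdiff_def finite_at_def)
qed

lemma frechet_subdiff_finite:
  assumes "v \<in> frechet_subdiff \<phi> x"
  obtains a where "\<phi> x = ereal a"
  using assms by (cases "\<phi> x") (auto simp: frechet_subdiff_def finite_at_def)

text \<open>A chain rule with an increasing outer function. Monotonicity alone transports the affine
lower bound of \<open>\<phi>\<close> through \<open>P\<close>; differentiability is then only used along these real bounds, so
\<open>P\<close> may be arbitrary at infinite values. Since only the germ of \<open>\<psi>\<close> at \<open>x\<close> enters, the rule also
says that subgradients are local.\<close>

lemma frechet_subdiff_mono_comp: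
  fixes \<phi> \<psi> :: "'a::euclidean_space \<Rightarrow> ereal"
  assumes v: "v \<in> frechet_subdiff \<phi> x" and a: "\<phi> x = ereal a"
    and P: "mono P" "\<forall>\<^sub>F b in nhds a. P (ereal b) = ereal (p b)"
    and p: "(p has_real_derivative D) (at a)"
    and \<psi>: "\<forall>\<^sub>F y in nhds x. \<psi> y = P (\<phi> y)"
  shows "D *\<^sub>R v \<in> frechet_subdiff \<psi> x"
proof -
  have \<psi>x: "\<psi> x = ereal (p a)"
    using eventually_nhds_x_imp_x[OF P(2)] eventually_nhds_x_imp_x[OF \<psi>] a by simp
  show ?thesis
    unfolding frechet_subdiff_iff[where \<phi> = \<psi> and x = x, OF \<psi>x]
  proof (intro allI impI)
    fix \<epsilon> :: real assume \<epsilon>: "\<epsilon> > 0"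
    \<comment> \<open>Half of the slope \<open>\<epsilon>\<close> pays for the error of \<open>\<phi>\<close>, the other half for that of \<open>p\<close>.\<close>
    define \<epsilon>1 where "\<epsilon>1 = \<epsilon> / (2 * (\<bar>D\<bar> + 1))"
    have \<epsilon>1: "\<epsilon>1 > 0" "\<bar>D\<bar> * \<epsilon>1 \<le> \<epsilon> / 2"
      using \<epsilon> by (auto simp: \<epsilon>1_def field_simps)
    define e where "e = \<epsilon> / (2 * (norm v + \<epsilon>1))"
    have nv: "norm v + \<epsilon>1 > 0" using \<epsilon>1 norm_ge_zero[of v] by linarith
    have e: "e > 0" "e * (norm v + \<epsilon>1) = \<epsilon> / 2"
      using \<epsilon> nv by (simp_all add: e_def del: distrib_left_numeral)
    define s where "s y = a + v \<bullet> (y - x) - \<epsilon>1 * norm (y - x)" for y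
    have s: "(s \<longlongrightarrow> a) (nhds x)"
      unfolding s_def by (auto intro!: tendsto_eq_intros filterlim_ident)
    have "\<forall>\<^sub>F b in nhds a. \<bar>p b - p a - D * (b - a)\<bar> \<le> e * \<bar>b - a\<bar>"
      using p e(1) unfolding has_field_derivative_def has_derivative_within_alt2 eventually_at_filter
      by (auto elim!: eventually_mono dest!: spec[of _ e])
    with P(2) have "\<forall>\<^sub>F b in nhds a. P (ereal b) = ereal (p b) \<and>
        \<bar>p b - p a - D * (b - a)\<bar> \<le> e * \<bar>b - a\<bar>"
      by (rule eventually_conj)
    from eventually_compose_filterlim[OF this s]
    have 1: "\<forall>\<^sub>F y in nhds x. P (ereal (s y)) = ereal (p (s y)) \<and>
        \<bar>p (s y) - p a - D * (s y - a)\<bar> \<le> e * \<bar>s y - a\<bar>" .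
    have "\<forall>\<^sub>F y in nhds x. ereal (s y) \<le> \<phi> y"
      using v \<epsilon>1 unfolding frechet_subdiff_iff[where \<phi> = \<phi> and x = x, OF a] s_def by blast
    with 1 \<psi> show "\<forall>\<^sub>F y in nhds x.
        ereal (p a + D *\<^sub>R v \<bullet> (y - x) - \<epsilon> * norm (y - x)) \<le> \<psi> y"
    proof eventually_elim
      case (elim y)
      have "\<bar>s y - a\<bar> \<le> \<bar>v \<bullet> (y - x)\<bar> + \<epsilon>1 * norm (y - x)"
        using mult_nonneg_nonneg[OF less_imp_le[OF \<epsilon>1(1)] norm_ge_zero[of "y - x"]]
        unfolding s_def by linarith
      also have "\<dots> \<le> (norm v + \<epsilon>1) * norm (y - x)"
        using Cauchy_Schwarz_ineq2[of v "y - x"] by (simp add: algebra_simps)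
      finally have "e * \<bar>s y - a\<bar> \<le> e * ((norm v + \<epsilon>1) * norm (y - x))"
        using e(1) by simp
      then have A: "e * \<bar>s y - a\<bar> \<le> \<epsilon> / 2 * norm (y - x)"
        using e(2) by (metis mult.assoc)
      have "D * \<epsilon>1 \<le> \<epsilon> / 2" using \<epsilon>1 by (smt (verit) mult_right_mono)
      then have "D * \<epsilon>1 * norm (y - x) \<le> \<epsilon> / 2 * norm (y - x)"
        by (rule mult_right_mono) simp
      then have "p a + D *\<^sub>R v \<bullet> (y - x) - \<epsilon> * norm (y - x) \<le> p (s y)"
        using A elim(1) by (simp add: s_def algebra_simps abs_le_iff)
      moreover have "P (ereal (s y)) \<le> \<psi> y"
        using monoD[OF P(1) elim(3)] elim(2) by simp
      ultimately show ?case using elim(1) by (metis ereal_less_eq(3) order_trans)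
    qed
  qed
qed

lemma frechet_subdiff_cong:
  fixes \<phi> \<psi> :: "'a::euclidean_space \<Rightarrow> ereal"
  assumes v: "v \<in> frechet_subdiff \<phi> x" and eq: "\<forall>\<^sub>F y in nhds x. \<psi> y = \<phi> y"
  shows "v \<in> frechet_subdiff \<psi> x"
proof -
  obtain a where "\<phi> x = ereal a" using v by (rule frechet_subdiff_finite)
  from frechet_subdiff_mono_comp[OF v this, of "\<lambda>b. b" "\<lambda>b. b" 1 \<psi>] eq
  show ?thesis by (simp add: mono_def)
qed

text \<open>Undoing an affine change of variables and of values multiplies subgradients by the ratio of
the two scaling factors.\<close>

lemma frechet_subdiff_rescale:
  fixes f :: "'a::euclidean_space \<Rightarrow> ereal"
  assumes v: "v \<in> frechet_subdiff (\<lambda>w. (f (x + t *\<^sub>R w) - ereal c) / ereal s) w"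
    and st: "t > 0" "s > 0"
  shows "(s / t) *\<^sub>R v \<in> frechet_subdiff f (x + t *\<^sub>R w)"
proof -
  obtain a where a: "(f (x + t *\<^sub>R w) - ereal c) / ereal s = ereal a"
    using v by (rule frechet_subdiff_finite)
  have fx: "f (x + t *\<^sub>R w) = ereal (c + s * a)"
    using a st by (cases "f (x + t *\<^sub>R w)") (auto simp: field_simps split: if_splits)
  show ?thesis
    unfolding frechet_subdiff_iff[where \<phi> = f and x = "x + t *\<^sub>R w", OF fx]
  proof (intro allI impI)
    fix \<epsilon> :: real assume \<epsilon>: "\<epsilon> > 0"
    define \<epsilon>1 where "\<epsilon>1 = \<epsilon> * t / s"
    have "\<epsilon>1 > 0" using \<epsilon> st by (simp add: \<epsilon>1_def)
    define Y where "Y y = (1 / t) *\<^sub>R (y - x)" for y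
    have "(Y \<longlongrightarrow> w) (nhds (x + t *\<^sub>R w))"
      unfolding Y_def using st by (auto intro!: tendsto_eq_intros filterlim_ident)
    moreover have "\<forall>\<^sub>F y in nhds w. ereal (a + v \<bullet> (y - w) - \<epsilon>1 * norm (y - w))
        \<le> (f (x + t *\<^sub>R y) - ereal c) / ereal s"
      using v \<open>\<epsilon>1 > 0\<close> frechet_subdiff_iff[where \<phi> = "\<lambda>w. (f (x + t *\<^sub>R w) - ereal c) / ereal s", OF a]
      by blast
    ultimately have "\<forall>\<^sub>F y in nhds (x + t *\<^sub>R w). ereal (a + v \<bullet> (Y y - w) - \<epsilon>1 * norm (Y y - w))
        \<le> (f (x + t *\<^sub>R Y y) - ereal c) / ereal s"
      by (rule eventually_compose_filterlim[rotated])
    then show "\<forall>\<^sub>F y in nhds (x + t *\<^sub>R w).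
        ereal (c + s * a + (s / t) *\<^sub>R v \<bullet> (y - (x + t *\<^sub>R w)) - \<epsilon> * norm (y - (x + t *\<^sub>R w))) \<le> f y"
    proof eventually_elim
      case (elim y)
      have 1: "x + t *\<^sub>R Y y = y" using st by (simp add: Y_def)
      have 2: "y - (x + t *\<^sub>R w) = t *\<^sub>R (Y y - w)"
        using st by (simp add: Y_def algebra_simps)
      have "\<epsilon> * t = s * \<epsilon>1" using st by (simp add: \<epsilon>1_def)
      then have 3: "c + s * a + (s / t) *\<^sub>R v \<bullet> (y - (x + t *\<^sub>R w)) - \<epsilon> * norm (y - (x + t *\<^sub>R w))
          = c + s * (a + v \<bullet> (Y y - w) - \<epsilon>1 * norm (Y y - w))"
        unfolding 2 using st by (simp add: distrib_left right_diff_distrib)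
      show ?case unfolding 3 using elim st unfolding 1
        by (cases "f y") (auto simp: field_simps split: if_splits)
    qed
  qed
qed

text \<open>Euler's identity needs the values on the ray through \<open>x\<close> only: there \<open>\<phi>\<close> is the differentiable
function \<open>l powr p * a\<close>, which the subgradient inequality supports from below on both sides of
\<open>l = 1\<close>, and so its derivative \<open>p * a\<close> must equal the slope \<open>v \<bullet> x\<close> of the support.\<close>

lemma frechet_subdiff_euler:
  fixes \<phi> :: "'a::euclidean_space \<Rightarrow> ereal"
  assumes v: "v \<in> frechet_subdiff \<phi> x" and a: "\<phi> x = ereal a"
    and hom: "\<And>l. l > 0 \<Longrightarrow> \<phi> (l *\<^sub>R x) = ereal (l powr p * a)"
  shows "v \<bullet> x = p * a"
proof -
  define D where "D = p * a - v \<bullet> x"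
  have "\<bar>D\<bar> \<le> e" if e: "e > 0" for e
  proof -
    define \<epsilon> where "\<epsilon> = e / (2 * (norm x + 1))"
    have nx: "norm x + 1 > 0" using norm_ge_zero[of x] by linarith
    have \<epsilon>: "\<epsilon> > 0" "\<epsilon> * norm x \<le> e / 2"
      using e nx by (auto simp: \<epsilon>_def field_simps)
    have "((\<lambda>l. l *\<^sub>R x) \<longlongrightarrow> x) (nhds (1::real))"
      by (auto intro!: tendsto_eq_intros filterlim_ident)
    moreover have "\<forall>\<^sub>F y in nhds x. ereal (a + v \<bullet> (y - x) - \<epsilon> * norm (y - x)) \<le> \<phi> y"
      using v \<epsilon> unfolding frechet_subdiff_iff[where \<phi> = \<phi> and x = x, OF a] by blast
    ultimately have 1: "\<forall>\<^sub>F l in nhds (1::real).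
        ereal (a + v \<bullet> (l *\<^sub>R x - x) - \<epsilon> * norm (l *\<^sub>R x - x)) \<le> \<phi> (l *\<^sub>R x)"
      by (rule eventually_compose_filterlim[rotated])
    have 2: "\<forall>\<^sub>F l in nhds (1::real). l > 0"
      by (rule eventually_nhds_in_open[of "{0<..}", simplified]) auto
    have "((\<lambda>l. l powr p * a) has_real_derivative p * a) (at 1)"
      by (auto intro!: derivative_eq_intros)
    then have 3: "\<forall>\<^sub>F l in nhds (1::real). \<bar>l powr p * a - a - p * a * (l - 1)\<bar> \<le> e / 2 * \<bar>l - 1\<bar>"
      using e unfolding has_field_derivative_def has_derivative_within_alt2 eventually_at_filter
      by (auto elim!: eventually_mono dest!: spec[of _ "e/2"])
    have "\<forall>\<^sub>F l in nhds (1::real). - (e * \<bar>l - 1\<bar>) \<le> D * (l - 1)"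
      using 1 2 3
    proof eventually_elim
      case (elim l)
      have x: "l *\<^sub>R x - x = (l - 1) *\<^sub>R x" by (simp add: algebra_simps)
      have "a + (l - 1) * (v \<bullet> x) - \<epsilon> * (\<bar>l - 1\<bar> * norm x) \<le> l powr p * a"
        using elim(1) unfolding x hom[OF elim(2)] by simp
      moreover have "\<epsilon> * norm x * \<bar>l - 1\<bar> \<le> e / 2 * \<bar>l - 1\<bar>"
        by (rule mult_right_mono[OF \<epsilon>(2)]) simp
      moreover have "l powr p * a \<le> a + p * a * (l - 1) + e / 2 * \<bar>l - 1\<bar>"
        using elim(3) by linarith
      moreover have "D * (l - 1) = p * a * (l - 1) - (l - 1) * (v \<bullet> x)"
        by (simp add: D_def algebra_simps)
      moreover have "\<epsilon> * (\<bar>l - 1\<bar> * norm x) = \<epsilon> * norm x * \<bar>l - 1\<bar>" by simp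
      ultimately show ?case by linarith
    qed
    then obtain d where d: "d > 0" "\<And>l. \<bar>l - 1\<bar> < d \<Longrightarrow> - (e * \<bar>l - 1\<bar>) \<le> D * (l - 1)"
      unfolding eventually_nhds_metric dist_real_def by blast
    have "- (e * (d / 2)) \<le> D * (d / 2)" "- (e * (d / 2)) \<le> - (D * (d / 2))"
      using d(2)[of "1 + d / 2"] d(2)[of "1 - d / 2"] d(1) by auto
    then have "(- e) * (d / 2) \<le> D * (d / 2)" "D * (d / 2) \<le> e * (d / 2)" by linarith+
    then have "- e \<le> D" "D \<le> e" using d(1) by (meson half_gt_zero mult_right_le_imp_le)+
    then show ?thesis by linarith
  qed
  then have "D = 0" by (metis abs_le_zero_iff field_le_epsilon add_0)
  then show ?thesis by (simp add: D_def)
qed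

section \<open>Limiting subgradients\<close>

lemma limiting_subdiff_finite:
  assumes "v \<in> limiting_subdiff \<phi> x"
  obtains a where "\<phi> x = ereal a"
  using assms by (cases "\<phi> x") (auto simp: limiting_subdiff_def finite_at_def)

text \<open>The defining conditions may fail for finitely many indices: a shift of the sequence removes
them.\<close>

lemma limiting_subdiffI:
  assumes "finite_at \<phi> x" "xs \<longlonglongrightarrow> x" "vs \<longlonglongrightarrow> v" "(\<lambda>k. \<phi> (xs k)) \<longlonglongrightarrow> \<phi> x"
    and "\<forall>\<^sub>F k in sequentially. vs k \<in> frechet_subdiff \<phi> (xs k)"
  shows "v \<in> limiting_subdiff \<phi> x"
proof -
  obtain N where N: "\<And>k. k \<ge> N \<Longrightarrow> vs k \<in> frechet_subdiff \<phi> (xs k)"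
    using assms(5) by (auto simp: eventually_sequentially)
  show ?thesis
    unfolding limiting_subdiff_def
    by (intro CollectI conjI assms(1), rule exI[of _ "\<lambda>k. xs (k + N)"],
        rule exI[of _ "\<lambda>k. vs (k + N)"])
      (use assms(2-4)[THEN LIMSEQ_ignore_initial_segment, of N] N in simp)
qed

lemma frechet_subdiff_subset_limiting: "frechet_subdiff \<phi> x \<subseteq> limiting_subdiff \<phi> x"
proof
  fix v assume "v \<in> frechet_subdiff \<phi> x"
  then show "v \<in> limiting_subdiff \<phi> x"
    by (intro limiting_subdiffI[of _ _ "\<lambda>_. x" "\<lambda>_. v"]) (auto simp: frechet_subdiff_def)
qed

lemma outer_limiting_subdiffI:
  assumes "finite_at \<phi> x" "xs \<longlonglongrightarrow> x" "vs \<longlonglongrightarrow> v" "(\<lambda>k. \<phi> (xs k)) \<longlonglongrightarrow> \<phi> x"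
    and "\<forall>\<^sub>F k in sequentially. \<phi> x < \<phi> (xs k) \<and> vs k \<in> limiting_subdiff \<phi> (xs k)"
  shows "v \<in> outer_limiting_subdiff \<phi> x"
proof -
  obtain N where N: "\<And>k. k \<ge> N \<Longrightarrow> \<phi> x < \<phi> (xs k) \<and> vs k \<in> limiting_subdiff \<phi> (xs k)"
    using assms(5) by (auto simp: eventually_sequentially)
  show ?thesis
    unfolding outer_limiting_subdiff_def
    by (intro CollectI conjI assms(1), rule exI[of _ "\<lambda>k. xs (k + N)"],
        rule exI[of _ "\<lambda>k. vs (k + N)"])
      (use assms(2-4)[THEN LIMSEQ_ignore_initial_segment, of N] N in simp)
qed

text \<open>Functions that agree near \<open>x\<close> agree near every point of a sequence close enough to \<open>x\<close>.\<close>

lemma limiting_subdiff_cong: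
  fixes \<phi> \<psi> :: "'a::euclidean_space \<Rightarrow> ereal"
  assumes v: "v \<in> limiting_subdiff \<phi> x" and eq: "\<forall>\<^sub>F y in nhds x. \<psi> y = \<phi> y"
  shows "v \<in> limiting_subdiff \<psi> x"
proof -
  obtain xs vs where xs: "xs \<longlonglongrightarrow> x" "vs \<longlonglongrightarrow> v" "(\<lambda>k. \<phi> (xs k)) \<longlonglongrightarrow> \<phi> x"
    and vs: "\<And>k. vs k \<in> frechet_subdiff \<phi> (xs k)" and fin: "finite_at \<phi> x"
    using v by (auto simp: limiting_subdiff_def)
  have eqx: "\<psi> x = \<phi> x" using eq by (rule eventually_nhds_x_imp_x)
  have "\<forall>\<^sub>F y in nhds x. \<forall>\<^sub>F z in nhds y. \<psi> z = \<phi> z" using eq by (simp add: eventually_eventually)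
  then have ev: "\<forall>\<^sub>F k in sequentially. \<forall>\<^sub>F z in nhds (xs k). \<psi> z = \<phi> z"
    using xs(1) by (rule eventually_compose_filterlim)
  show ?thesis
  proof (rule limiting_subdiffI[OF _ xs(1,2)])
    show "finite_at \<psi> x" using fin by (simp add: finite_at_def eqx)
    have "\<forall>\<^sub>F k in sequentially. \<phi> (xs k) = \<psi> (xs k)"
      using ev by eventually_elim (drule eventually_nhds_x_imp_x, simp)
    then show "(\<lambda>k. \<psi> (xs k)) \<longlonglongrightarrow> \<psi> x"
      unfolding eqx by (rule Lim_transform_eventually[OF xs(3)])
    show "\<forall>\<^sub>F k in sequentially. vs k \<in> frechet_subdiff \<psi> (xs k)"
      using ev by eventually_elim (rule frechet_subdiff_cong[OF vs])
  qed
qed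

lemma limiting_subdiff_euler:
  fixes \<phi> :: "'a::euclidean_space \<Rightarrow> ereal"
  assumes v: "v \<in> limiting_subdiff \<phi> x" and a: "\<phi> x = ereal a"
    and hom: "\<And>l w. l > 0 \<Longrightarrow> \<phi> (l *\<^sub>R w) = ereal (l powr p) * \<phi> w"
  shows "v \<bullet> x = p * a"
proof -
  obtain xs vs where xs: "xs \<longlonglongrightarrow> x" "vs \<longlonglongrightarrow> v" "(\<lambda>k. \<phi> (xs k)) \<longlonglongrightarrow> \<phi> x"
    and vs: "\<And>k. vs k \<in> frechet_subdiff \<phi> (xs k)"
    using v by (auto simp: limiting_subdiff_def)
  have "\<exists>b. \<phi> (xs k) = ereal b" for k using frechet_subdiff_finite[OF vs] by metis
  then obtain as where as: "\<And>k. \<phi> (xs k) = ereal (as k)" by metis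
  have lim: "as \<longlonglongrightarrow> a" using xs(3) by (simp add: as a)
  have "vs k \<bullet> xs k = p * as k" for k
    by (rule frechet_subdiff_euler[OF vs as]) (simp add: hom as)
  then have "(\<lambda>k. vs k \<bullet> xs k) \<longlonglongrightarrow> p * a" using lim by (auto intro!: tendsto_intros)
  moreover have "(\<lambda>k. vs k \<bullet> xs k) \<longlonglongrightarrow> v \<bullet> x" using xs by (intro tendsto_intros)
  ultimately show ?thesis using LIMSEQ_unique by blast
qed

section \<open>Powers of positive parts\<close>

lemma epowr_ereal: "epowr (ereal r) c = ereal (r powr c)"
  by (simp add: epowr_def)

lemma epowr_max_ereal: "epowr (max (ereal r) 0) c = ereal (max r 0 powr c)"
  by (simp add: epowr_def max_def)

lemma mono_pos_powr:
  assumes "c > 0" shows "mono (\<lambda>a. epowr (max a 0) c)"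
proof (rule monoI)
  fix a b :: ereal assume "a \<le> b"
  then show "epowr (max a 0) c \<le> epowr (max b 0) c"
    using assms by (cases a; cases b) (auto simp: epowr_def max_def intro!: powr_mono2)
qed

lemma continuous_on_pos_powr:
  assumes c: "c > 0" shows "continuous_on UNIV (\<lambda>a. epowr (max a 0) c)"
proof -
  \<comment> \<open>Continued by the identity below zero, the power becomes an increasing bijection of the
    extended reals, and such maps are continuous.\<close>
  define Q where "Q a = (if 0 \<le> a then epowr a c else a)" for a
  have "mono Q"
  proof (rule monoI)
    fix a b :: ereal assume "a \<le> b"
    then show "Q a \<le> Q b"
      using c by (cases a; cases b) (auto simp: Q_def epowr_def intro: powr_mono2 order_trans[OF _ powr_ge_zero])
  qed
  moreover have "surj Q"
  proof (rule surjI)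
    fix b
    show "Q (if 0 \<le> b then epowr b (1 / c) else b) = b"
      using c by (cases b) (auto simp: Q_def epowr_def powr_powr)
  qed
  ultimately have "continuous_on UNIV Q"
    by (intro continuous_onI_mono) (auto dest: monoD)
  then have "continuous_on UNIV (\<lambda>a. Q (max a 0))"
    by (rule continuous_on_compose2) (auto intro!: continuous_intros)
  moreover have "Q (max a 0) = epowr (max a 0) c" for a by (simp add: Q_def)
  ultimately show ?thesis by simp
qed

text \<open>The approximating values converge to the positive number \<open>a\<close>, so that eventually the chain rule for
Frechet subgradients applies to them, and its derivative factor is continuous.\<close>

lemma limiting_subdiff_pos_powr:
  fixes \<phi> \<psi> :: "'a::euclidean_space \<Rightarrow> ereal"
  assumes v: "v \<in> limiting_subdiff \<phi> x" and a: "\<phi> x = ereal a" "a > 0" and c: "c > 0"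
  shows "(c * a powr (c - 1)) *\<^sub>R v \<in> limiting_subdiff (\<lambda>y. epowr (max (\<phi> y) 0) c) x"
    (is "_ \<in> limiting_subdiff ?\<psi> x")
proof -
  obtain xs vs where xs: "xs \<longlonglongrightarrow> x" "vs \<longlonglongrightarrow> v" "(\<lambda>k. \<phi> (xs k)) \<longlonglongrightarrow> \<phi> x"
    and vs: "\<And>k. vs k \<in> frechet_subdiff \<phi> (xs k)"
    using v by (auto simp: limiting_subdiff_def)
  have "\<exists>b. \<phi> (xs k) = ereal b" for k using frechet_subdiff_finite[OF vs] by metis
  then obtain as where as: "\<And>k. \<phi> (xs k) = ereal (as k)" by metis
  have lim: "as \<longlonglongrightarrow> a" using xs(3) by (simp add: as a)
  have pos: "\<forall>\<^sub>F k in sequentially. as k > 0" using lim a(2) by (rule order_tendstoD)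
  show ?thesis
  proof (rule limiting_subdiffI)
    show "finite_at ?\<psi> x" by (simp add: finite_at_def a epowr_def)
    show "xs \<longlonglongrightarrow> x" by fact
    show "(\<lambda>k. (c * as k powr (c - 1)) *\<^sub>R vs k) \<longlonglongrightarrow> (c * a powr (c - 1)) *\<^sub>R v"
      using lim xs(2) a(2) by (auto intro!: tendsto_intros)
    show "(\<lambda>k. ?\<psi> (xs k)) \<longlonglongrightarrow> ?\<psi> x"
      using continuous_on_tendsto_compose[OF continuous_on_pos_powr[OF c] xs(3)] by simp
    show "\<forall>\<^sub>F k in sequentially. (c * as k powr (c - 1)) *\<^sub>R vs k \<in> frechet_subdiff ?\<psi> (xs k)"
      using pos
    proof eventually_elim
      case (elim k)
      have "\<forall>\<^sub>F b in nhds (as k). b > 0"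
        using elim by (rule order_tendstoD[OF filterlim_ident])
      then have "\<forall>\<^sub>F b in nhds (as k). epowr (max (ereal b) 0) c = ereal (b powr c)"
        by eventually_elim (simp add: epowr_def max_def)
      moreover have "((\<lambda>b. b powr c) has_real_derivative c * as k powr (c - 1)) (at (as k))"
        using elim by (auto intro!: derivative_eq_intros)
      ultimately show ?case
        by (intro frechet_subdiff_mono_comp[OF vs as mono_pos_powr[OF c]]) auto
    qed
  qed
qed

text \<open>Lower semicontinuity makes \<open>H > 0\<close> an open condition, so that truncation at zero changes nothing
near \<open>x\<close>.\<close>

lemma limiting_subdiff_pos_part:
  fixes H :: "'a::euclidean_space \<Rightarrow> ereal"
  assumes "lsc H" "0 < H x" "v \<in> limiting_subdiff (\<lambda>y. max (H y) 0) x"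
  shows "v \<in> limiting_subdiff H x"
proof (rule limiting_subdiff_cong[OF assms(3)])
  have "0 < Liminf (nhds x) H" using assms(1,2) unfolding lsc_def by (meson less_le_trans)
  then have "\<forall>\<^sub>F y in nhds x. 0 < H y" by (rule less_LiminfD)
  then show "\<forall>\<^sub>F y in nhds x. H y = max (H y) 0"
    by eventually_elim (simp add: max_absorb1 less_imp_le)
qed

text \<open>The inclusion from right to left is the chain rule. For the other one, apply the chain rule
with exponent \<open>1 / c\<close> to the power, which gives back \<open>max H 0\<close>; the two derivative factors
are reciprocal.\<close>

lemma limiting_subdiff_pos_powr_eq:
  fixes H :: "'a::euclidean_space \<Rightarrow> ereal"
  assumes lsc: "lsc H" and a: "H w = ereal a" "a > 0" and c: "c > 0"
  shows "limiting_subdiff (\<lambda>y. epowr (max (H y) 0) c) w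
    = (\<lambda>v. (c * a powr (c - 1)) *\<^sub>R v) ` limiting_subdiff H w"
    (is "limiting_subdiff ?G w = _")
proof (intro equalityI subsetI)
  fix u assume u: "u \<in> limiting_subdiff ?G w"
  have Gw: "?G w = ereal (a powr c)" "a powr c > 0" using a by (simp_all add: epowr_ereal)
  have "epowr (max (?G y) 0) (1 / c) = max (H y) 0" for y
    using c by (cases "H y") (auto simp: epowr_def max_def powr_powr)
  then have "(1 / c * (a powr c) powr (1 / c - 1)) *\<^sub>R u \<in> limiting_subdiff (\<lambda>y. max (H y) 0) w"
    using limiting_subdiff_pos_powr[OF u Gw, of "1 / c"] c by simp
  then have "(1 / c * (a powr c) powr (1 / c - 1)) *\<^sub>R u \<in> limiting_subdiff H w"
    using a by (intro limiting_subdiff_pos_part[OF lsc]) auto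
  moreover have "(c * a powr (c - 1)) * (1 / c * (a powr c) powr (1 / c - 1)) = 1"
  proof -
    have "c * (1 / c - 1) = 1 - c" using c by (simp add: algebra_simps)
    then have "(a powr c) powr (1 / c - 1) = a powr (1 - c)" by (simp add: powr_powr)
    then show ?thesis using c a by (simp add: powr_add[symmetric])
  qed
  then have "u = (c * a powr (c - 1)) *\<^sub>R (1 / c * (a powr c) powr (1 / c - 1)) *\<^sub>R u" by simp
  ultimately show "u \<in> (\<lambda>v. (c * a powr (c - 1)) *\<^sub>R v) ` limiting_subdiff H w" by blast
next
  fix u assume "u \<in> (\<lambda>v. (c * a powr (c - 1)) *\<^sub>R v) ` limiting_subdiff H w"
  then show "u \<in> limiting_subdiff ?G w" using limiting_subdiff_pos_powr[where \<phi> = H and x = w, OF _ a c] by auto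
qed

section \<open>Functions that are homogeneous of degree one\<close>

lemma LIMSEQ_0_if_le_inverse_Suc:
  fixes f :: "nat \<Rightarrow> real"
  assumes "\<And>k. \<bar>f k\<bar> \<le> 1 / real (Suc k)"
  shows "f \<longlonglongrightarrow> 0"
proof (rule Lim_null_comparison[OF always_eventually])
  show "(\<lambda>k. 1 / real (Suc k)) \<longlonglongrightarrow> 0"
    using LIMSEQ_inverse_real_of_nat by (simp add: inverse_eq_divide)
qed (use assms in simp)

text \<open>A function that is homogeneous of degree one equals its own rescaling, and so its subgradients do
not change along rays.\<close>

lemma limiting_subdiff_homogeneous:
  fixes G :: "'a::euclidean_space \<Rightarrow> ereal"
  assumes hom: "\<And>l w. l > 0 \<Longrightarrow> G (l *\<^sub>R w) = ereal l * G w" and l: "l > 0"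
    and v: "v \<in> limiting_subdiff G x"
  shows "v \<in> limiting_subdiff G (l *\<^sub>R x)"
proof -
  obtain xs vs where xs: "xs \<longlonglongrightarrow> x" "vs \<longlonglongrightarrow> v" "(\<lambda>k. G (xs k)) \<longlonglongrightarrow> G x"
    and vs: "\<And>k. vs k \<in> frechet_subdiff G (xs k)" and fin: "finite_at G x"
    using v by (auto simp: limiting_subdiff_def)
  have G: "(\<lambda>w. (G (0 + l *\<^sub>R w) - ereal 0) / ereal l) = G"
  proof
    fix w show "(G (0 + l *\<^sub>R w) - ereal 0) / ereal l = G w"
      using l by (cases "G w") (auto simp: hom)
  qed
  show ?thesis
  proof (rule limiting_subdiffI[of _ _ "\<lambda>k. l *\<^sub>R xs k" vs])
    show "finite_at G (l *\<^sub>R x)" using fin l by (cases "G x") (auto simp: finite_at_def hom)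
    show "(\<lambda>k. l *\<^sub>R xs k) \<longlonglongrightarrow> l *\<^sub>R x" by (intro tendsto_intros xs)
    show "(\<lambda>k. G (l *\<^sub>R xs k)) \<longlonglongrightarrow> G (l *\<^sub>R x)"
      unfolding hom[OF l] by (rule tendsto_cmult_ereal) (use xs in auto)
    have "vs k \<in> frechet_subdiff G (l *\<^sub>R xs k)" for k
      using frechet_subdiff_rescale[of "vs k" G 0 l 0 l "xs k"] vs[of k] l unfolding G by simp
    then show "\<forall>\<^sub>F k in sequentially. vs k \<in> frechet_subdiff G (l *\<^sub>R xs k)" by simp
  qed (rule xs)
qed

text \<open>A subgradient at any point with positive finite value is also one at points of the same ray that
are as close to the origin, in position and in value, as desired. Hence the approach to the origin
puts no restriction on these subgradients, and only a closure remains to be taken.\<close>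

lemma outer_limiting_subdiff_homogeneous:
  fixes G :: "'a::euclidean_space \<Rightarrow> ereal"
  assumes hom: "\<And>l w. l > 0 \<Longrightarrow> G (l *\<^sub>R w) = ereal l * G w" and G0: "G 0 = 0"
  shows "outer_limiting_subdiff G 0 = closure (\<Union>w\<in>{w. 0 < G w \<and> G w < \<infinity>}. limiting_subdiff G w)"
    (is "_ = closure ?U")
proof (intro equalityI subsetI)
  fix v assume "v \<in> outer_limiting_subdiff G 0"
  then obtain xs vs where vs: "vs \<longlonglongrightarrow> v" and *: "\<And>k. G 0 < G (xs k) \<and> vs k \<in> limiting_subdiff G (xs k)"
    by (auto simp: outer_limiting_subdiff_def)
  have "vs k \<in> ?U" for k
  proof -
    obtain a where "G (xs k) = ereal a" using * limiting_subdiff_finite by metis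
    then show ?thesis using *[of k] by (auto simp: G0 intro!: exI[of _ "xs k"])
  qed
  then show "v \<in> closure ?U" using vs unfolding closure_sequential by blast
next
  fix v assume "v \<in> closure ?U"
  then obtain vs where vs: "vs \<longlonglongrightarrow> v" "\<And>k. vs k \<in> ?U" unfolding closure_sequential by blast
  then have "\<exists>w. 0 < G w \<and> G w < \<infinity> \<and> vs k \<in> limiting_subdiff G w" for k by blast
  then obtain ws where ws: "\<And>k. 0 < G (ws k)" "\<And>k. G (ws k) < \<infinity>"
    "\<And>k. vs k \<in> limiting_subdiff G (ws k)" by metis
  define as where "as k = real_of_ereal (G (ws k))" for k
  have as: "G (ws k) = ereal (as k)" "as k > 0" for k
    using ws(1,2)[of k] by (cases "G (ws k)"; simp add: as_def)+
  \<comment> \<open>This factor makes both the norm of the rescaled point and its value at most \<open>1 / Suc k\<close>.\<close>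
  define l where "l k = 1 / (real (Suc k) * (1 + norm (ws k) + as k))" for k
  have den: "1 + norm (ws k) + as k > 0" for k
    using as(2)[of k] norm_ge_zero[of "ws k"] by linarith
  have l: "l k > 0" for k using den[of k] by (simp add: l_def)
  have bound: "l k * s \<le> 1 / real (Suc k)" if "s \<le> 1 + norm (ws k) + as k" for k s
    using that den[of k] by (simp add: l_def divide_simps)
  have "(\<lambda>k. norm (l k *\<^sub>R ws k)) \<longlonglongrightarrow> 0"
    by (rule LIMSEQ_0_if_le_inverse_Suc)
      (use bound as(2) l in \<open>simp add: less_imp_le del: of_nat_Suc\<close>)
  then have 1: "(\<lambda>k. l k *\<^sub>R ws k) \<longlonglongrightarrow> 0" by (rule tendsto_norm_zero_cancel)
  have "(\<lambda>k. l k * as k) \<longlonglongrightarrow> 0"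
    by (rule LIMSEQ_0_if_le_inverse_Suc)
      (use bound as(2) l in \<open>simp add: less_imp_le abs_mult del: of_nat_Suc\<close>)
  then have "(\<lambda>k. ereal (l k * as k)) \<longlonglongrightarrow> ereal 0" by simp
  moreover have val: "G (l k *\<^sub>R ws k) = ereal (l k * as k)" for k
    by (simp add: hom[OF l] as(1))
  ultimately have 2: "(\<lambda>k. G (l k *\<^sub>R ws k)) \<longlonglongrightarrow> G 0" by (simp add: G0 zero_ereal_def)
  show "v \<in> outer_limiting_subdiff G 0"
    by (rule outer_limiting_subdiffI[OF _ 1 vs(1) 2])
      (use l as(2) limiting_subdiff_homogeneous[OF hom l ws(3)] in
        \<open>auto simp: finite_at_def G0 val intro!: always_eventually\<close>)
qed

section \<open>Subgradients by penalization\<close>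

text \<open>A minimizer of \<open>\<phi> + q\<close> over the ball lies in its interior, because the values on the sphere exceed
the one at \<open>w1\<close>; since \<open>q\<close> is smooth, minus its gradient at the minimizer is a Frechet subgradient.
The penalty is quadratic, rather than a multiple of the norm, precisely to be smooth at the centre
\<open>w\<close> as well. Closedness is assumed only for the part of the epigraph between the heights \<open>-M\<close> and \<open>M\<close>,
which is all that local lower semicontinuity provides for blow-ups.\<close>

lemma frechet_subgradient_by_penalization:
  fixes \<phi> :: "'a::euclidean_space \<Rightarrow> ereal" and w v :: 'a and K :: real
  defines "q \<equiv> \<lambda>y. K * (norm (y - w))\<^sup>2 - v \<bullet> (y - w)"
  assumes cl: "closed (epi \<phi> \<inter> cball w \<delta> \<times> {-M..M})"
    and low: "\<And>y. y \<in> cball w \<delta> \<Longrightarrow> ereal (-M) \<le> \<phi> y"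
    and w1: "w1 \<in> cball w \<delta>" "\<phi> w1 = ereal b"
    and up: "\<And>y. y \<in> cball w \<delta> \<Longrightarrow> b + q w1 < M + q y"
    and sph: "\<And>y. dist w y = \<delta> \<Longrightarrow> ereal (b + q w1 - q y) < \<phi> y"
  obtains w' a where "w' \<in> ball w \<delta>" "\<phi> w' = ereal a" "a + q w' \<le> b + q w1"
    "v - (2 * K) *\<^sub>R (w' - w) \<in> frechet_subdiff \<phi> w'"
proof -
  \<comment> \<open>The minimum is taken over this compact piece of the epigraph, on which the objective
    \<open>(y, s) \<mapsto> s + q y\<close> is continuous.\<close>
  define S where "S = epi \<phi> \<inter> cball w \<delta> \<times> {-M..M}"
  have "compact (cball w \<delta> \<times> {-M..M})" by (intro compact_Times) auto
  then have "compact ((cball w \<delta> \<times> {-M..M}) \<inter> S)"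
    using cl unfolding S_def by (rule compact_Int_closed)
  then have "compact S" by (simp add: S_def Int_absorb1)
  moreover have w1S: "(w1, b) \<in> S"
    using w1 low[OF w1(1)] up[OF w1(1)] by (auto simp: S_def epi_def)
  moreover have "continuous_on S (\<lambda>z. snd z + q (fst z))"
    unfolding q_def by (intro continuous_intros)
  ultimately obtain z where z: "z \<in> S"
    and zmin: "\<And>z'. z' \<in> S \<Longrightarrow> snd z + q (fst z) \<le> snd z' + q (fst z')"
    using continuous_attains_inf[of S "\<lambda>z. snd z + q (fst z)"] by blast
  define w' where "w' = fst z"
  have w': "w' \<in> cball w \<delta>" "\<phi> w' \<le> ereal (snd z)" "snd z \<le> M"
    using z by (auto simp: S_def epi_def w'_def)
  obtain a where a: "\<phi> w' = ereal a" "a \<le> snd z" "-M \<le> a"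
    using w' low[OF w'(1)] by (cases "\<phi> w'") auto
  have "(w', a) \<in> S" using w' a by (auto simp: S_def epi_def)
  then have az: "snd z = a" using zmin[of "(w', a)"] a by (simp add: w'_def)
  have less: "a + q w' \<le> b + q w1" using zmin[OF w1S] by (simp add: az w'_def)
  have min: "ereal (a + q w' - q y) \<le> \<phi> y" if y: "y \<in> cball w \<delta>" for y
  proof (cases "\<phi> y")
    case (real s)
    show ?thesis
    proof (cases "s \<le> M")
      case True
      then have "(y, s) \<in> S" using y real low[OF y] by (auto simp: S_def epi_def)
      from zmin[OF this] show ?thesis by (simp add: az w'_def real)
    next
      case False
      then show ?thesis using up[OF y] less real by simp
    qed
  qed (use low[OF y] in auto)
  have "dist w w' \<noteq> \<delta>" using sph[of w'] less a by auto
  then have ball: "w' \<in> ball w \<delta>" using w'(1) by auto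
  have "v - (2 * K) *\<^sub>R (w' - w) \<in> frechet_subdiff \<phi> w'"
    unfolding frechet_subdiff_iff[where \<phi> = \<phi> and x = w', OF a(1)]
  proof (intro allI impI)
    fix \<epsilon> :: real assume \<epsilon>: "\<epsilon> > 0"
    have "((\<lambda>y. K * norm (y - w')) \<longlongrightarrow> 0) (nhds w')"
      by (auto intro!: tendsto_eq_intros filterlim_ident)
    then have "\<forall>\<^sub>F y in nhds w'. K * norm (y - w') < \<epsilon>" using \<epsilon> by (rule order_tendstoD)
    moreover have "\<forall>\<^sub>F y in nhds w'. y \<in> ball w \<delta>"
      using ball by (intro eventually_nhds_in_open) auto
    ultimately show "\<forall>\<^sub>F y in nhds w'. ereal (a + (v - (2 * K) *\<^sub>R (w' - w)) \<bullet> (y - w')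
        - \<epsilon> * norm (y - w')) \<le> \<phi> y"
    proof eventually_elim
      case (elim y)
      have n: "(norm (y - w))\<^sup>2 = (norm (w' - w))\<^sup>2 + 2 * ((w' - w) \<bullet> (y - w')) + (norm (y - w'))\<^sup>2"
        unfolding power2_norm_eq_inner
        by (simp add: inner_diff_left inner_diff_right inner_commute algebra_simps)
      have "K * (norm (y - w'))\<^sup>2 = K * norm (y - w') * norm (y - w')"
        by (simp add: power2_eq_square)
      also have "\<dots> \<le> \<epsilon> * norm (y - w')"
        using elim(1) by (intro mult_right_mono) auto
      finally have "K * (norm (y - w'))\<^sup>2 \<le> \<epsilon> * norm (y - w')" .
      moreover have "q w' - q y = (v - (2 * K) *\<^sub>R (w' - w)) \<bullet> (y - w') - K * (norm (y - w'))\<^sup>2"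
        unfolding q_def n by (simp add: inner_diff_left inner_diff_right algebra_simps)
      ultimately have "a + (v - (2 * K) *\<^sub>R (w' - w)) \<bullet> (y - w') - \<epsilon> * norm (y - w') \<le> a + q w' - q y"
        by simp
      moreover have "ereal (a + q w' - q y) \<le> \<phi> y" using elim(2) by (intro min) auto
      ultimately show ?case by (meson ereal_less_eq(3) order_trans)
    qed
  qed
  with ball a(1) less show thesis by (rule that)
qed

lemma lsc_closed_epi:
  fixes \<phi> :: "'a::first_countable_topology \<Rightarrow> ereal"
  assumes "lsc \<phi>" shows "closed (epi \<phi>)"
  unfolding closed_sequential_limits
proof (intro allI impI, elim conjE)
  fix zs z assume zs: "\<forall>n. zs n \<in> epi \<phi>" and lim: "zs \<longlonglongrightarrow> z"
  obtain x \<alpha> where z: "z = (x, \<alpha>)" by fastforce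
  show "z \<in> epi \<phi>"
  proof (rule ccontr)
    assume "z \<notin> epi \<phi>"
    then have "ereal \<alpha> < \<phi> x" by (simp add: z epi_def)
    then obtain b where b: "\<alpha> < b" "ereal b < \<phi> x" using ereal_dense2 by force
    have "ereal b < Liminf (nhds x) \<phi>" using assms b(2) by (auto simp: lsc_def intro: less_le_trans)
    then have "\<forall>\<^sub>F y in nhds x. ereal b < \<phi> y" by (rule less_LiminfD)
    moreover have "(\<lambda>n. fst (zs n)) \<longlonglongrightarrow> x" using tendsto_fst[OF lim] z by simp
    ultimately have "\<forall>\<^sub>F n in sequentially. ereal b < \<phi> (fst (zs n))"
      by (rule eventually_compose_filterlim)
    moreover have "(\<lambda>n. snd (zs n)) \<longlonglongrightarrow> \<alpha>" using tendsto_snd[OF lim] z by simp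
    then have "\<forall>\<^sub>F n in sequentially. snd (zs n) < b" using b(1) by (rule order_tendstoD)
    ultimately have "\<forall>\<^sub>F n in sequentially. False"
    proof eventually_elim
      case (elim n)
      have "\<phi> (fst (zs n)) \<le> ereal (snd (zs n))" using zs by (auto simp: epi_def case_prod_beta)
      with elim show ?case by (meson ereal_less_eq(3) less_imp_le not_less order_trans)
    qed
    then show False by simp
  qed
qed

text \<open>Penalization with \<open>v = 0\<close>: with \<open>K\<close> so large that the penalty on a small sphere exceeds \<open>\<phi> w\<close>,
positivity of \<open>\<phi>\<close> on the ball keeps the minimizer in the interior and its value positive.\<close>

lemma lsc_ex_frechet_subgradient:
  fixes \<phi> :: "'a::euclidean_space \<Rightarrow> ereal"
  assumes lsc: "lsc \<phi>" and w: "\<phi> w = ereal a" and a: "a > 0"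
  obtains w' a' v where "\<phi> w' = ereal a'" "0 < a'" "v \<in> frechet_subdiff \<phi> w'"
proof -
  have "ereal 0 < \<phi> w" using w a by simp
  also have "\<phi> w \<le> Liminf (nhds w) \<phi>" using lsc by (simp add: lsc_def)
  finally have "ereal 0 < Liminf (nhds w) \<phi>" .
  then have "\<forall>\<^sub>F y in nhds w. ereal 0 < \<phi> y" by (rule less_LiminfD)
  then obtain d where d: "d > 0" "\<And>y. dist y w < d \<Longrightarrow> 0 < \<phi> y"
    unfolding eventually_nhds_metric by (auto simp: zero_ereal_def)
  define \<delta> where "\<delta> = d / 2"
  have \<delta>: "\<delta> > 0" "\<And>y. dist w y \<le> \<delta> \<Longrightarrow> 0 < \<phi> y" using d by (auto simp: \<delta>_def dist_commute)
  define K where "K = 2 * a / \<delta>\<^sup>2"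
  have K: "K > 0" "K * \<delta>\<^sup>2 = 2 * a" using a \<delta> by (auto simp: K_def)
  obtain w' a' where w': "w' \<in> ball w \<delta>" "\<phi> w' = ereal a'"
    and v: "0 - (2 * K) *\<^sub>R (w' - w) \<in> frechet_subdiff \<phi> w'"
  proof (rule frechet_subgradient_by_penalization[where \<phi> = \<phi> and w = w and v = 0 and K = K
        and \<delta> = \<delta> and M = "2 * a" and b = a and ?w1.0 = w])
    show "closed (epi \<phi> \<inter> cball w \<delta> \<times> {- (2 * a)..2 * a})"
      by (intro closed_Int closed_Times lsc_closed_epi lsc) auto
    show "ereal (- (2 * a)) \<le> \<phi> y" if "y \<in> cball w \<delta>" for y
      using \<delta>(2)[of y] that a by (cases "\<phi> y") auto
    show "a + (K * (norm (w - w))\<^sup>2 - 0 \<bullet> (w - w)) < 2 * a + (K * (norm (y - w))\<^sup>2 - 0 \<bullet> (y - w))" for y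
      using a K(1) by (simp add: add_strict_increasing)
    show "ereal (a + (K * (norm (w - w))\<^sup>2 - 0 \<bullet> (w - w)) - (K * (norm (y - w))\<^sup>2 - 0 \<bullet> (y - w))) < \<phi> y"
      if "dist w y = \<delta>" for y
    proof -
      have "norm (y - w) = \<delta>" using that by (simp add: dist_norm norm_minus_commute)
      then have "a + (K * (norm (w - w))\<^sup>2 - 0 \<bullet> (w - w)) - (K * (norm (y - w))\<^sup>2 - 0 \<bullet> (y - w)) < 0"
        using K a by simp
      with \<delta>(2)[of y] that show ?thesis
        by (metis less_ereal.simps(1) less_trans order_refl zero_ereal_def)
    qed
  qed (use w \<delta> in auto)
  have "0 < a'" using \<delta>(2)[of w'] w' by simp
  then show thesis using that w'(2) v by blast
qed

section \<open>Subgradients of lower epi-limits\<close>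

text \<open>The lower epi-limit (also called lower Gamma-limit) of the functions \<open>\<phi> t\<close> as \<open>t\<close> decreases to
zero.\<close>

definition epi_liminf :: "(real \<Rightarrow> 'a::topological_space \<Rightarrow> ereal) \<Rightarrow> 'a \<Rightarrow> ereal" where
  "epi_liminf \<phi> w = Liminf (at_right 0 \<times>\<^sub>F nhds w) (\<lambda>(t, w'). \<phi> t w')"

lemma at_right_prod_nhds_neq_bot: "at_right (0::real) \<times>\<^sub>F nhds w \<noteq> bot"
  by (simp add: prod_filter_eq_bot)

lemma lsc_epi_liminf: "lsc (epi_liminf \<phi>)"
  unfolding lsc_def le_Liminf_iff
proof (intro allI impI)
  fix w b assume "b < epi_liminf \<phi> w"
  then obtain c where c: "b < c" "c < epi_liminf \<phi> w" using dense by blast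
  from c(2) have "\<forall>\<^sub>F z in at_right 0 \<times>\<^sub>F nhds w. c < (case z of (t, w') \<Rightarrow> \<phi> t w')"
    unfolding epi_liminf_def by (rule less_LiminfD)
  then obtain P Q where P: "eventually P (at_right 0)" and Q: "eventually Q (nhds w)"
    and PQ: "\<And>t y. P t \<Longrightarrow> Q y \<Longrightarrow> c < \<phi> t y"
    unfolding eventually_prod_filter by auto
  from Q have "\<forall>\<^sub>F y in nhds w. eventually Q (nhds y)" by (simp add: eventually_eventually)
  then show "\<forall>\<^sub>F y in nhds w. b < epi_liminf \<phi> y"
  proof eventually_elim
    case (elim y)
    have "\<forall>\<^sub>F z in at_right 0 \<times>\<^sub>F nhds y. c \<le> (case z of (t, w') \<Rightarrow> \<phi> t w')"
      unfolding eventually_prod_filter using P elim PQ by (fastforce intro: less_imp_le)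
    then have "c \<le> epi_liminf \<phi> y" unfolding epi_liminf_def by (rule Liminf_bounded)
    with c(1) show ?case by simp
  qed
qed

text \<open>The recovery half of epi-convergence: values of the approximating functions near \<open>w\<close> that come
close to the limit.\<close>

lemma epi_liminf_less_imp_ex:
  assumes "epi_liminf \<phi> w < C" "eventually P (at_right 0)" "eventually Q (nhds w)"
  shows "\<exists>t w'. P t \<and> Q w' \<and> \<phi> t w' < C"
proof (rule ccontr)
  assume "\<not> ?thesis"
  then have "\<forall>\<^sub>F z in at_right 0 \<times>\<^sub>F nhds w. C \<le> (case z of (t, w') \<Rightarrow> \<phi> t w')"
    unfolding eventually_prod_filter using assms(2,3) by (auto simp: not_less intro!: exI[of _ P] exI[of _ Q])
  then have "C \<le> epi_liminf \<phi> w" unfolding epi_liminf_def by (rule Liminf_bounded)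
  with assms(1) show False by simp
qed

text \<open>A strict lower bound that holds for the epi-limit at every point of a compact set holds for the
approximating functions uniformly on the set: points of failure would accumulate at a point of the set, which
is impossible because the limit inferior is taken jointly in \<open>t\<close> and in the point.\<close>

lemma compact_less_epi_liminf:
  fixes S :: "'a::metric_space set" and \<psi> :: "'a \<Rightarrow> real"
  assumes S: "compact S" and \<psi>: "continuous_on S \<psi>"
    and less: "\<And>y. y \<in> S \<Longrightarrow> ereal (\<psi> y) < epi_liminf \<phi> y"
  shows "\<forall>\<^sub>F t in at_right 0. \<forall>y\<in>S. ereal (\<psi> y) < \<phi> t y"
proof (rule ccontr)
  assume neg: "\<not> ?thesis"
  have "\<exists>t y. 0 < t \<and> t < 1 / real (Suc n) \<and> y \<in> S \<and> \<phi> t y \<le> ereal (\<psi> y)" for n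
    using neg unfolding eventually_at_right_field
    by (auto simp: not_less dest!: spec[of _ "1 / real (Suc n)"])
  then obtain T Y where T: "\<And>n. 0 < T n" "\<And>n. T n < 1 / real (Suc n)"
    and Y: "\<And>n. Y n \<in> S" "\<And>n. \<phi> (T n) (Y n) \<le> ereal (\<psi> (Y n))"
    by metis
  obtain l r where l: "l \<in> S" and r: "strict_mono r" and lim: "(Y \<circ> r) \<longlonglongrightarrow> l"
    using S Y(1) unfolding compact_def by metis
  obtain b where b: "\<psi> l < b" "ereal b < epi_liminf \<phi> l"
    using ereal_dense2[OF less[OF l]] by auto
  have "T \<longlonglongrightarrow> 0"
    by (rule LIMSEQ_0_if_le_inverse_Suc) (use T[THEN less_imp_le] in simp)
  then have "(T \<circ> r) \<longlonglongrightarrow> 0" using r by (rule LIMSEQ_subseq_LIMSEQ)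
  moreover have "T n \<noteq> 0" for n using T(1)[of n] by simp
  ultimately have "filterlim (T \<circ> r) (at_right 0) sequentially"
    using T(1) by (simp add: filterlim_at)
  from filterlim_Pair[OF this lim]
  have "filterlim (\<lambda>n. (T (r n), Y (r n))) (at_right 0 \<times>\<^sub>F nhds l) sequentially" by simp
  moreover have "\<forall>\<^sub>F z in at_right 0 \<times>\<^sub>F nhds l. ereal b < (case z of (t, w') \<Rightarrow> \<phi> t w')"
    using b(2) unfolding epi_liminf_def by (rule less_LiminfD)
  ultimately have "\<forall>\<^sub>F n in sequentially. ereal b < \<phi> (T (r n)) (Y (r n))"
    by (auto dest: eventually_compose_filterlim)
  moreover have "(\<lambda>n. \<psi> (Y (r n))) \<longlonglongrightarrow> \<psi> l"
    using continuous_on_tendsto_compose[OF \<psi> lim l] Y(1) by simp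
  then have "\<forall>\<^sub>F n in sequentially. \<psi> (Y (r n)) < b" using b(1) by (rule order_tendstoD)
  ultimately have "\<forall>\<^sub>F n in sequentially. False"
  proof eventually_elim
    case (elim n)
    then show ?case using Y(2)[of "r n"] by (meson ereal_less_eq(3) less_imp_le not_less order_trans)
  qed
  then show False by simp
qed

text \<open>The subgradient inequality with a small slope error \<open>\<epsilon>\<close> says that \<open>epi_liminf \<phi> + q\<close> is at least
\<open>a - \<epsilon> \<delta>\<close> on a ball of radius \<open>\<delta>\<close> and, as the penalty contributes \<open>2 \<epsilon> \<delta>\<close> there, \<open>a + \<epsilon> \<delta>\<close> on its
sphere. Both bounds pass, slightly weakened, to \<open>\<phi> t\<close> by compactness, and a recovery point provides a value of
\<open>\<phi> t + q\<close> below the bound on the sphere. Penalization then gives a subgradient of \<open>\<phi> t\<close> that differs from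
\<open>v\<close> by at most \<open>2 K \<delta> = 4 \<epsilon>\<close>, at a point whose value is squeezed between the two bounds.\<close>

lemma frechet_subdiff_epi_liminf_approx:
  fixes \<phi> :: "real \<Rightarrow> 'a::euclidean_space \<Rightarrow> ereal"
  assumes cl: "\<And>R M. \<forall>\<^sub>F t in at_right 0. closed (epi (\<phi> t) \<inter> cball 0 R \<times> {-M..M})"
    and v: "v \<in> frechet_subdiff (epi_liminf \<phi>) w" and a: "epi_liminf \<phi> w = ereal a"
    and \<eta>: "\<eta> > 0"
  obtains t w' b v' where "0 < t" "t < \<eta>" "dist w' w < \<eta>" "dist v' v < \<eta>"
    "\<phi> t w' = ereal b" "\<bar>b - a\<bar> < \<eta>" "v' \<in> frechet_subdiff (\<phi> t) w'"
proof -
  define \<epsilon> where "\<epsilon> = \<eta> / 8"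
  have \<epsilon>: "\<epsilon> > 0" using \<eta> by (simp add: \<epsilon>_def)
  have "\<forall>\<^sub>F y in nhds w. ereal (a + v \<bullet> (y - w) - \<epsilon> * norm (y - w)) \<le> epi_liminf \<phi> y"
    using v \<epsilon> unfolding frechet_subdiff_iff[where \<phi> = "epi_liminf \<phi>" and x = w, OF a] by blast
  then obtain d where d: "d > 0"
    "\<And>y. dist y w < d \<Longrightarrow> ereal (a + v \<bullet> (y - w) - \<epsilon> * norm (y - w)) \<le> epi_liminf \<phi> y"
    unfolding eventually_nhds_metric by blast
  have den: "norm v + 4 * \<epsilon> > 0" using \<epsilon> norm_ge_zero[of v] by linarith
  \<comment> \<open>Besides the distance of the new point, \<open>\<delta>\<close> controls the change of value, which is at most
    \<open>\<delta> * (norm v + 4 * \<epsilon>)\<close>.\<close>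
  define \<delta> where "\<delta> = min (d / 2) (min (\<eta> / 2) (\<eta> / (2 * (norm v + 4 * \<epsilon>))))"
  have \<delta>: "\<delta> > 0" "\<delta> < d" "\<delta> < \<eta>" "\<delta> * (norm v + 4 * \<epsilon>) < \<eta>"
  proof -
    show "\<delta> > 0" "\<delta> < d" "\<delta> < \<eta>" using d \<eta> den by (auto simp: \<delta>_def)
    have "\<delta> \<le> \<eta> / (2 * (norm v + 4 * \<epsilon>))" by (simp add: \<delta>_def)
    then have "\<delta> * (norm v + 4 * \<epsilon>) \<le> \<eta> / (2 * (norm v + 4 * \<epsilon>)) * (norm v + 4 * \<epsilon>)"
      using den by (intro mult_right_mono) auto
    also have "\<dots> = \<eta> / 2" using den by (simp del: distrib_left_numeral)
    finally show "\<delta> * (norm v + 4 * \<epsilon>) < \<eta>" using \<eta> by simp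
  qed
  \<comment> \<open>With this \<open>K\<close> the penalty on the sphere of radius \<open>\<delta>\<close> is twice the slope error \<open>\<epsilon> * \<delta>\<close>.\<close>
  define K where "K = 2 * \<epsilon> / \<delta>"
  have K: "K > 0" "K * \<delta> = 2 * \<epsilon>" using \<epsilon> \<delta> by (auto simp: K_def)
  define q where "q y = K * (norm (y - w))\<^sup>2 - v \<bullet> (y - w)" for y
  have q_cont: "continuous_on X q" for X unfolding q_def by (intro continuous_intros)
  define B where "B = \<delta> * (norm v + 2 * \<epsilon>)"
  have q_bound: "\<bar>q y\<bar> \<le> B" if "y \<in> cball w \<delta>" for y
  proof -
    have n: "norm (y - w) \<le> \<delta>" using that by (simp add: dist_norm norm_minus_commute)
    have "\<bar>v \<bullet> (y - w)\<bar> \<le> norm v * norm (y - w)" by (rule Cauchy_Schwarz_ineq2)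
    also have "\<dots> \<le> norm v * \<delta>" using n by (intro mult_left_mono) auto
    finally have 1: "\<bar>v \<bullet> (y - w)\<bar> \<le> norm v * \<delta>" .
    have "K * (norm (y - w))\<^sup>2 \<le> K * \<delta>\<^sup>2" using n K(1) by (intro mult_left_mono power_mono) auto
    also have "K * \<delta>\<^sup>2 = 2 * \<epsilon> * \<delta>" by (simp add: power2_eq_square K(2) flip: mult.assoc)
    finally have 2: "K * (norm (y - w))\<^sup>2 \<le> 2 * \<epsilon> * \<delta>" .
    have 3: "0 \<le> K * (norm (y - w))\<^sup>2" using K(1) by simp
    have "B = norm v * \<delta> + 2 * \<epsilon> * \<delta>" by (simp add: B_def algebra_simps)
    then show ?thesis using 1 2 3 unfolding q_def by linarith
  qed
  have lower: "ereal (a + K * (norm (y - w))\<^sup>2 - \<epsilon> * norm (y - w) - q y) \<le> epi_liminf \<phi> y"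
    if "y \<in> cball w \<delta>" for y
  proof -
    have eq: "a + K * (norm (y - w))\<^sup>2 - \<epsilon> * norm (y - w) - q y = a + v \<bullet> (y - w) - \<epsilon> * norm (y - w)"
      by (simp add: q_def)
    show ?thesis unfolding eq using d(2)[of y] that \<delta>(2) by (simp add: dist_commute)
  qed
  have \<epsilon>\<delta>: "\<epsilon> * \<delta> > 0" using \<epsilon> \<delta> by simp
  have ev_ball: "\<forall>\<^sub>F t in at_right 0. \<forall>y\<in>cball w \<delta>. ereal (a - 2 * (\<epsilon> * \<delta>) - q y) < \<phi> t y"
  proof (rule compact_less_epi_liminf)
    fix y assume y: "y \<in> cball w \<delta>"
    have "\<epsilon> * norm (y - w) \<le> \<epsilon> * \<delta>"
      using y \<epsilon> by (intro mult_left_mono) (auto simp: dist_norm norm_minus_commute)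
    moreover have "0 \<le> K * (norm (y - w))\<^sup>2" using K(1) by simp
    ultimately have "a - 2 * (\<epsilon> * \<delta>) - q y < a + K * (norm (y - w))\<^sup>2 - \<epsilon> * norm (y - w) - q y"
      using \<epsilon>\<delta> by linarith
    with lower[OF y] show "ereal (a - 2 * (\<epsilon> * \<delta>) - q y) < epi_liminf \<phi> y"
      by (meson ereal_less(2) less_ereal.simps(1) less_le_trans)
  qed (auto intro!: continuous_intros q_cont)
  have ev_sphere: "\<forall>\<^sub>F t in at_right 0. \<forall>y\<in>sphere w \<delta>. ereal (a + \<epsilon> * \<delta> / 2 - q y) < \<phi> t y"
  proof (rule compact_less_epi_liminf)
    fix y assume y: "y \<in> sphere w \<delta>"
    then have n: "norm (y - w) = \<delta>" by (simp add: dist_norm norm_minus_commute)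
    have "K * \<delta>\<^sup>2 = 2 * (\<epsilon> * \<delta>)" by (simp add: power2_eq_square K(2) flip: mult.assoc)
    then have "a + \<epsilon> * \<delta> / 2 - q y < a + K * (norm (y - w))\<^sup>2 - \<epsilon> * norm (y - w) - q y"
      unfolding n using \<epsilon>\<delta> by linarith
    moreover have "y \<in> cball w \<delta>" using y by simp
    ultimately show "ereal (a + \<epsilon> * \<delta> / 2 - q y) < epi_liminf \<phi> y"
      using lower by (meson less_ereal.simps(1) less_le_trans)
  qed (auto intro!: continuous_intros q_cont)
  \<comment> \<open>Large enough for every value that matters on the ball to lie between \<open>-M\<close> and \<open>M\<close>.\<close>
  define M where "M = \<bar>a\<bar> + 3 * (\<epsilon> * \<delta>) + 2 * B"
  have B: "B \<ge> 0" using q_bound[of w] \<delta> by auto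
  have ev_closed: "\<forall>\<^sub>F t in at_right 0. closed (epi (\<phi> t) \<inter> cball w \<delta> \<times> {-M..M})"
    using cl[of "norm w + \<delta>" M]
  proof eventually_elim
    case (elim t)
    have "cball w \<delta> \<subseteq> cball 0 (norm w + \<delta>)"
      by (auto simp: dist_norm norm_minus_commute) (metis add_left_mono norm_triangle_sub order_trans)
    then have "epi (\<phi> t) \<inter> cball w \<delta> \<times> {-M..M}
        = (epi (\<phi> t) \<inter> cball 0 (norm w + \<delta>) \<times> {-M..M}) \<inter> cball w \<delta> \<times> {-M..M}" by auto
    then show ?case using elim by (metis closed_Int closed_Times closed_atLeastAtMost closed_cball)
  qed
  have ev_small: "\<forall>\<^sub>F t in at_right 0. 0 < t \<and> t < \<eta>"
    using \<eta> by (auto simp: eventually_at_right_field)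
  have ev_q: "\<forall>\<^sub>F y in nhds w. q y < \<epsilon> * \<delta> / 4 \<and> y \<in> cball w \<delta>"
  proof (rule eventually_conj)
    have "isCont q w" using q_cont[of UNIV] by (simp add: continuous_on_eq_continuous_at)
    then have "(q \<longlongrightarrow> q w) (nhds w)" by (simp add: isCont_def tendsto_at_iff_tendsto_nhds)
    then show "\<forall>\<^sub>F y in nhds w. q y < \<epsilon> * \<delta> / 4"
      by (rule order_tendstoD) (use \<epsilon>\<delta> in \<open>simp add: q_def\<close>)
    have "\<forall>\<^sub>F y in nhds w. y \<in> ball w \<delta>" using \<delta>(1) by (intro eventually_nhds_in_open) auto
    then show "\<forall>\<^sub>F y in nhds w. y \<in> cball w \<delta>" by eventually_elim auto
  qed
  have "epi_liminf \<phi> w < ereal (a + \<epsilon> * \<delta> / 4)" using a \<epsilon>\<delta> by simp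
  from epi_liminf_less_imp_ex[OF this eventually_conj[OF ev_small eventually_conj[OF ev_closed
      eventually_conj[OF ev_ball ev_sphere]]] ev_q]
  obtain t w1 where t: "0 < t" "t < \<eta>" "closed (epi (\<phi> t) \<inter> cball w \<delta> \<times> {-M..M})"
    and t_ball: "\<And>y. y \<in> cball w \<delta> \<Longrightarrow> ereal (a - 2 * (\<epsilon> * \<delta>) - q y) < \<phi> t y"
    and t_sphere: "\<And>y. y \<in> sphere w \<delta> \<Longrightarrow> ereal (a + \<epsilon> * \<delta> / 2 - q y) < \<phi> t y"
    and w1: "q w1 < \<epsilon> * \<delta> / 4" "w1 \<in> cball w \<delta>" "\<phi> t w1 < ereal (a + \<epsilon> * \<delta> / 4)"
    by blast
  obtain b1 where b1: "\<phi> t w1 = ereal b1" "b1 < a + \<epsilon> * \<delta> / 4"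
    using w1(3) t_ball[OF w1(2)] by (cases "\<phi> t w1") auto
  have b1q: "b1 + q w1 < a + \<epsilon> * \<delta> / 2" using b1(2) w1(1) by simp
  obtain w' b where w': "w' \<in> ball w \<delta>" "\<phi> t w' = ereal b" "b + q w' \<le> b1 + q w1"
    and sub: "v - (2 * K) *\<^sub>R (w' - w) \<in> frechet_subdiff (\<phi> t) w'"
  proof (rule frechet_subgradient_by_penalization[where \<phi> = "\<phi> t" and w = w and v = v and K = K
        and \<delta> = \<delta> and M = M and b = b1, OF t(3) _ w1(2) b1(1), folded q_def])
    fix y assume y: "y \<in> cball w \<delta>"
    have qy: "\<bar>q y\<bar> \<le> B" using q_bound[OF y] .
    then have "- M \<le> a - 2 * (\<epsilon> * \<delta>) - q y" unfolding M_def using B \<epsilon>\<delta> by linarith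
    with t_ball[OF y] show "ereal (- M) \<le> \<phi> t y"
      by (meson ereal_less_eq(3) less_imp_le order_trans)
    show "b1 + q w1 < M + q y" unfolding M_def using qy b1q B \<epsilon>\<delta> by linarith
  next
    fix y assume y: "dist w y = \<delta>"
    then have "y \<in> sphere w \<delta>" by simp
    moreover have "b1 + q w1 - q y < a + \<epsilon> * \<delta> / 2 - q y" using b1q by simp
    ultimately show "ereal (b1 + q w1 - q y) < \<phi> t y"
      using t_sphere by (meson less_ereal.simps(1) less_trans)
  qed blast
  have w'c: "w' \<in> cball w \<delta>" using w'(1) by auto
  have "a - 2 * (\<epsilon> * \<delta>) - q w' < b" using t_ball[OF w'c] w'(2) by simp
  moreover have "b \<le> a + \<epsilon> * \<delta> / 2 - q w'" using w'(3) b1q by simp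
  moreover have "B + 2 * (\<epsilon> * \<delta>) < \<eta>" using \<delta>(4) by (simp add: B_def algebra_simps)
  ultimately have b: "\<bar>b - a\<bar> < \<eta>" using q_bound[OF w'c] \<epsilon>\<delta> by linarith
  have "dist (v - (2 * K) *\<^sub>R (w' - w)) v = 2 * (K * norm (w' - w))"
    using K(1) by (simp add: dist_norm)
  also have "\<dots> \<le> 2 * (K * \<delta>)"
    using w'c K(1) by (simp add: dist_norm norm_minus_commute)
  also have "\<dots> < \<eta>" using \<eta> by (simp add: K(2) \<epsilon>_def)
  finally have dv: "dist (v - (2 * K) *\<^sub>R (w' - w)) v < \<eta>" .
  have "dist w' w < \<eta>" using w'(1) \<delta>(3) by (simp add: dist_commute)
  from that[OF t(1,2) this dv w'(2) b sub] show thesis .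
qed

text \<open>A diagonal sequence: approximate the \<open>k\<close>-th Frechet subgradient in a sequence that defines \<open>v\<close> to within
\<open>1 / Suc k\<close>.\<close>

lemma limiting_subdiff_epi_liminf_approx:
  fixes \<phi> :: "real \<Rightarrow> 'a::euclidean_space \<Rightarrow> ereal"
  assumes cl: "\<And>R M. \<forall>\<^sub>F t in at_right 0. closed (epi (\<phi> t) \<inter> cball 0 R \<times> {-M..M})"
    and v: "v \<in> limiting_subdiff (epi_liminf \<phi>) w" and a: "epi_liminf \<phi> w = ereal a"
  obtains ts ws as vs where "\<And>k. 0 < ts k" "ts \<longlonglongrightarrow> 0" "ws \<longlonglongrightarrow> w" "as \<longlonglongrightarrow> a" "vs \<longlonglongrightarrow> v"
    "\<And>k. \<phi> (ts k) (ws k) = ereal (as k)" "\<And>k. vs k \<in> frechet_subdiff (\<phi> (ts k)) (ws k)"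
proof -
  obtain xs us where xs: "xs \<longlonglongrightarrow> w" "us \<longlonglongrightarrow> v" "(\<lambda>k. epi_liminf \<phi> (xs k)) \<longlonglongrightarrow> epi_liminf \<phi> w"
    and us: "\<And>k. us k \<in> frechet_subdiff (epi_liminf \<phi>) (xs k)"
    using v by (auto simp: limiting_subdiff_def)
  have "\<exists>b. epi_liminf \<phi> (xs k) = ereal b" for k using frechet_subdiff_finite[OF us] by metis
  then obtain cs where cs: "\<And>k. epi_liminf \<phi> (xs k) = ereal (cs k)" by metis
  have lim: "cs \<longlonglongrightarrow> a" using xs(3) by (simp add: cs a)
  have "\<exists>t w' b v'. 0 < t \<and> t < 1 / real (Suc k) \<and> dist w' (xs k) < 1 / real (Suc k)
      \<and> dist v' (us k) < 1 / real (Suc k) \<and> \<phi> t w' = ereal b \<and> \<bar>b - cs k\<bar> < 1 / real (Suc k)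
      \<and> v' \<in> frechet_subdiff (\<phi> t) w'" for k
    by (rule frechet_subdiff_epi_liminf_approx[OF cl us cs, of "1 / real (Suc k)" k]) auto
  then obtain ts ws as vs where
    *: "\<And>k. 0 < ts k" "\<And>k. ts k < 1 / real (Suc k)" "\<And>k. dist (ws k) (xs k) < 1 / real (Suc k)"
      "\<And>k. dist (vs k) (us k) < 1 / real (Suc k)" "\<And>k. \<phi> (ts k) (ws k) = ereal (as k)"
      "\<And>k. \<bar>as k - cs k\<bar> < 1 / real (Suc k)" "\<And>k. vs k \<in> frechet_subdiff (\<phi> (ts k)) (ws k)"
    by metis
  have "ts \<longlonglongrightarrow> 0" by (rule LIMSEQ_0_if_le_inverse_Suc) (use *(1,2) in \<open>simp add: less_imp_le\<close>)
  moreover have "(\<lambda>k. ws k - xs k) \<longlonglongrightarrow> 0"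
    by (rule tendsto_norm_zero_cancel, rule LIMSEQ_0_if_le_inverse_Suc) (use *(3) in \<open>simp add: dist_norm less_imp_le\<close>)
  from tendsto_add[OF this xs(1)] have "ws \<longlonglongrightarrow> w" by simp
  moreover have "(\<lambda>k. vs k - us k) \<longlonglongrightarrow> 0"
    by (rule tendsto_norm_zero_cancel, rule LIMSEQ_0_if_le_inverse_Suc) (use *(4) in \<open>simp add: dist_norm less_imp_le\<close>)
  from tendsto_add[OF this xs(2)] have "vs \<longlonglongrightarrow> v" by simp
  moreover have "(\<lambda>k. as k - cs k) \<longlonglongrightarrow> 0"
    by (rule LIMSEQ_0_if_le_inverse_Suc) (use *(6) in \<open>simp add: less_imp_le\<close>)
  from tendsto_add[OF this lim] have "as \<longlonglongrightarrow> a" by simp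
  ultimately show thesis using *(1,5,7) by (intro that[of ts ws as vs])
qed

section \<open>Blow-ups of a function at a point\<close>

definition blowup :: "('a::real_vector \<Rightarrow> ereal) \<Rightarrow> 'a \<Rightarrow> real \<Rightarrow> real \<Rightarrow> 'a \<Rightarrow> ereal" where
  "blowup f x p t w = (f (x + t *\<^sub>R w) - f x) / ereal (t powr p)"

text \<open>The box \<open>cball 0 R \<times> {-M..M}\<close> is mapped by the affine change of variables of the blow-up into any given
neighbourhood of \<open>(x, f x)\<close> once \<open>t\<close> is small, and there the epigraph of \<open>f\<close> is closed. For a
fixed \<open>t\<close> nothing can be said about larger boxes.\<close>

lemma eventually_closed_epi_blowup:
  fixes f :: "'a::euclidean_space \<Rightarrow> ereal"
  assumes fin: "finite_at f x" and lsc: "locally_lsc_at f x" and p: "p > 0"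
  shows "\<forall>\<^sub>F t in at_right 0. closed (epi (blowup f x p t) \<inter> cball 0 R \<times> {-M..M})"
proof -
  obtain c where c: "f x = ereal c" using fin by (cases "f x") (auto simp: finite_at_def)
  obtain V where V: "(x, c) \<in> interior V" "closed (epi f \<inter> V)"
    using lsc by (auto simp: locally_lsc_at_def locally_closed_at_def c)
  obtain A B where AB: "open A" "open B" "x \<in> A" "c \<in> B" "A \<times> B \<subseteq> interior V"
    using open_prod_elim[OF open_interior V(1)] by (metis mem_Sigma_iff)
  obtain r1 where r1: "r1 > 0" "cball x r1 \<subseteq> A" using AB open_contains_cball by blast
  obtain r2 where r2: "r2 > 0" "cball c r2 \<subseteq> B" using AB open_contains_cball by blast
  have "((\<lambda>t. t * \<bar>R\<bar>) \<longlongrightarrow> 0 * \<bar>R\<bar>) (at_right (0::real))" by (intro tendsto_intros)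
  then have "((\<lambda>t. t * \<bar>R\<bar>) \<longlongrightarrow> 0) (at_right (0::real))" by simp
  then have e1: "\<forall>\<^sub>F t in at_right 0. t * \<bar>R\<bar> < r1" using r1(1) by (rule order_tendstoD)
  have "((\<lambda>t. t powr p) \<longlongrightarrow> 0 powr p) (at_right (0::real))"
    using p by (intro tendsto_powr') (auto simp: eventually_at_right_less intro!: tendsto_intros eventually_mono[OF eventually_at_right_less])
  then have "((\<lambda>t. t powr p * \<bar>M\<bar>) \<longlongrightarrow> 0 powr p * \<bar>M\<bar>) (at_right (0::real))"
    by (rule tendsto_mult_right)
  then have "((\<lambda>t. t powr p * \<bar>M\<bar>) \<longlongrightarrow> 0) (at_right (0::real))" by simp
  then have e2: "\<forall>\<^sub>F t in at_right 0. t powr p * \<bar>M\<bar> < r2" using r2(1) by (rule order_tendstoD)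
  show ?thesis using e1 e2 eventually_at_right_less[of 0]
  proof eventually_elim
    case (elim t)
    define \<Psi> where "\<Psi> z = (x + t *\<^sub>R fst z, c + t powr p * snd z)" for z :: "'a \<times> real"
    have "continuous_on UNIV \<Psi>" unfolding \<Psi>_def by (intro continuous_intros)
    then have "closed (\<Psi> -` (epi f \<inter> V))" by (rule closed_vimage[OF V(2)])
    then have "closed (\<Psi> -` (epi f \<inter> V) \<inter> cball 0 R \<times> {-M..M})"
      by (intro closed_Int closed_Times) auto
    also have "\<Psi> -` (epi f \<inter> V) \<inter> cball 0 R \<times> {-M..M}
        = epi (blowup f x p t) \<inter> cball 0 R \<times> {-M..M}"
    proof (intro set_eqI iffI)
      fix z :: "'a \<times> real"
      obtain w \<alpha> where z: "z = (w, \<alpha>)" by fastforce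
      have epi: "\<Psi> z \<in> epi f \<longleftrightarrow> z \<in> epi (blowup f x p t)"
        using elim(3) by (cases "f (x + t *\<^sub>R w)") (auto simp: z \<Psi>_def epi_def blowup_def c field_simps)
      {
        assume "z \<in> \<Psi> -` (epi f \<inter> V) \<inter> cball 0 R \<times> {-M..M}"
        then show "z \<in> epi (blowup f x p t) \<inter> cball 0 R \<times> {-M..M}" using epi by auto
      next
        assume zb: "z \<in> epi (blowup f x p t) \<inter> cball 0 R \<times> {-M..M}"
        then have w: "norm w \<le> R" "\<bar>\<alpha>\<bar> \<le> M" by (auto simp: z)
        have "t * norm w \<le> t * \<bar>R\<bar>" using w elim by (intro mult_left_mono) auto
        then have "t * norm w \<le> r1" using elim by linarith
        then have "x + t *\<^sub>R w \<in> cball x r1" using elim by (simp add: dist_norm)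
        moreover have "t powr p * \<bar>\<alpha>\<bar> \<le> t powr p * \<bar>M\<bar>" using w by (intro mult_left_mono) auto
        then have "t powr p * \<bar>\<alpha>\<bar> \<le> r2" using elim by linarith
        then have "c + t powr p * \<alpha> \<in> cball c r2" by (simp add: dist_real_def abs_mult)
        ultimately have "(x + t *\<^sub>R w, c + t powr p * \<alpha>) \<in> V"
          using r1(2) r2(2) AB(5) interior_subset[of V] by blast
        then have "\<Psi> z \<in> V" by (simp add: \<Psi>_def z)
        then show "z \<in> \<Psi> -` (epi f \<inter> V) \<inter> cball 0 R \<times> {-M..M}" using epi zb by auto
      }
    qed
    finally show ?case .
  qed
qed

text \<open>Replacing \<open>(t, w)\<close> by \<open>(l t, w / l)\<close> leaves the point \<open>x + t w\<close> unchanged and multiplies the blow-up by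
\<open>l powr (-p)\<close>.\<close>

lemma epi_liminf_blowup_scale_le:
  fixes f :: "'a::real_normed_vector \<Rightarrow> ereal"
  assumes l: "l > 0"
  shows "ereal (l powr p) * epi_liminf (blowup f x p) w \<le> epi_liminf (blowup f x p) (l *\<^sub>R w)"
proof -
  let ?F = "at_right (0::real) \<times>\<^sub>F nhds (l *\<^sub>R w)"
  have lim1: "filterlim (\<lambda>t. l * t) (at_right 0) (at_right (0::real))"
    using l by (auto simp: filterlim_at intro!: tendsto_eq_intros eventually_mono[OF eventually_at_right_less])
  have lim2: "((\<lambda>y. (1 / l) *\<^sub>R y) \<longlongrightarrow> w) (nhds (l *\<^sub>R w))"
    using l by (auto intro!: tendsto_eq_intros filterlim_ident)
  have "ereal (l powr p) * epi_liminf (blowup f x p) w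
      = Liminf (at_right 0 \<times>\<^sub>F nhds w) (\<lambda>z. ereal (l powr p) * (case z of (t, w') \<Rightarrow> blowup f x p t w'))"
    unfolding epi_liminf_def by (rule Liminf_ereal_mult_left[symmetric]) (auto simp: at_right_prod_nhds_neq_bot)
  also have "\<dots> \<le> epi_liminf (blowup f x p) (l *\<^sub>R w)"
    unfolding epi_liminf_def le_Liminf_iff
  proof (intro allI impI)
    fix b assume "b < Liminf (at_right 0 \<times>\<^sub>F nhds w)
        (\<lambda>z. ereal (l powr p) * (case z of (t, w') \<Rightarrow> blowup f x p t w'))"
    then have "\<forall>\<^sub>F z in at_right 0 \<times>\<^sub>F nhds w. b < ereal (l powr p) * (case z of (t, w') \<Rightarrow> blowup f x p t w')"
      by (rule less_LiminfD)
    then obtain P Q where PQ: "eventually P (at_right 0)" "eventually Q (nhds w)"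
      "\<And>t y. P t \<Longrightarrow> Q y \<Longrightarrow> b < ereal (l powr p) * blowup f x p t y"
      unfolding eventually_prod_filter by auto
    have P': "\<forall>\<^sub>F t in at_right 0. P (l * t) \<and> 0 < t"
      using eventually_compose_filterlim[OF PQ(1) lim1] eventually_at_right_less by (rule eventually_conj)
    have Q': "\<forall>\<^sub>F y in nhds (l *\<^sub>R w). Q ((1 / l) *\<^sub>R y)"
      using eventually_compose_filterlim[OF PQ(2) lim2] .
    have "b < blowup f x p t y" if "P (l * t) \<and> 0 < t" "Q ((1 / l) *\<^sub>R y)" for t y
    proof -
      have "ereal (l powr p) * blowup f x p (l * t) ((1 / l) *\<^sub>R y) = blowup f x p t y"
        using l that(1)
        by (cases "f (x + t *\<^sub>R y) - f x") (auto simp: blowup_def powr_mult)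
      then show ?thesis using PQ(3) that by metis
    qed
    then show "\<forall>\<^sub>F z in ?F. b < (case z of (t, w') \<Rightarrow> blowup f x p t w')"
      unfolding eventually_prod_filter
      by (intro exI[of _ "\<lambda>t. P (l * t) \<and> 0 < t"] exI[of _ "\<lambda>y. Q ((1 / l) *\<^sub>R y)"] conjI P' Q') auto
  qed
  finally show ?thesis .
qed

lemma epi_liminf_blowup_scale:
  fixes f :: "'a::real_normed_vector \<Rightarrow> ereal"
  assumes l: "l > 0"
  shows "epi_liminf (blowup f x p) (l *\<^sub>R w) = ereal (l powr p) * epi_liminf (blowup f x p) w"
    (is "?H (l *\<^sub>R w) = _")
proof (rule antisym)
  have "ereal (l powr p) * (ereal ((1 / l) powr p) * ?H (l *\<^sub>R w)) \<le> ereal (l powr p) * ?H w"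
    using epi_liminf_blowup_scale_le[of "1 / l" p f x "l *\<^sub>R w"] l
    by (intro ereal_mult_left_mono) auto
  moreover have "ereal (l powr p) * (ereal ((1 / l) powr p) * ?H (l *\<^sub>R w)) = ?H (l *\<^sub>R w)"
    using l by (simp add: mult.assoc[symmetric] powr_mult[symmetric])
  ultimately show "?H (l *\<^sub>R w) \<le> ereal (l powr p) * ?H w" by simp
qed (rule epi_liminf_blowup_scale_le[OF l])

text \<open>All blow-ups vanish at \<open>0\<close>, so that the limit there is at most \<open>0\<close>, and by homogeneity it is a fixed point of
multiplication by \<open>2 powr p > 1\<close>.\<close>

lemma epi_liminf_blowup_0:
  fixes f :: "'a::real_normed_vector \<Rightarrow> ereal"
  assumes fin: "finite_at f x" and p: "p > 0"
  shows "epi_liminf (blowup f x p) 0 = 0 \<or> epi_liminf (blowup f x p) 0 = -\<infinity>" (is "?H 0 = 0 \<or> _")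
proof -
  have "?H 0 \<le> 0"
  proof (rule ccontr)
    assume "\<not> ?H 0 \<le> 0"
    then have "0 < ?H 0" by simp
    then have "\<forall>\<^sub>F z in at_right 0 \<times>\<^sub>F nhds 0. 0 < (case z of (t, w') \<Rightarrow> blowup f x p t w')"
      unfolding epi_liminf_def by (rule less_LiminfD)
    then obtain P Q where PQ: "eventually P (at_right 0)" "eventually Q (nhds 0)"
      "\<And>t y. P t \<Longrightarrow> Q y \<Longrightarrow> 0 < blowup f x p t y"
      unfolding eventually_prod_filter by auto
    obtain t where "P t" using eventually_happens[OF PQ(1)] by auto
    with PQ have "0 < blowup f x p t 0" using eventually_nhds_x_imp_x by blast
    then show False using fin by (auto simp: blowup_def finite_at_def)
  qed
  moreover have "?H 0 = ereal (2 powr p) * ?H 0"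
    using epi_liminf_blowup_scale[of 2 f x p 0] by simp
  ultimately show ?thesis using p by (cases "?H 0") auto
qed

text \<open>By homogeneity the value \<open>-\<infinity>\<close> would spread along the open ray through \<open>w\<close>, and by lower
semicontinuity to the origin.\<close>

lemma epi_liminf_blowup_neq_MInfty:
  fixes f :: "'a::real_normed_vector \<Rightarrow> ereal"
  assumes "epi_liminf (blowup f x p) 0 = 0"
  shows "epi_liminf (blowup f x p) w \<noteq> -\<infinity>" (is "?H w \<noteq> _")
proof
  assume w: "?H w = -\<infinity>"
  have "?H 0 \<le> Liminf (nhds 0) ?H" using lsc_epi_liminf[of "blowup f x p"] by (simp add: lsc_def)
  moreover have "(-1 :: ereal) < ?H 0" using assms by simp
  ultimately have "- 1 < Liminf (nhds 0) ?H" by (rule less_le_trans[rotated])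
  then have "\<forall>\<^sub>F y in nhds 0. - 1 < ?H y" by (rule less_LiminfD)
  moreover have "((\<lambda>l. l *\<^sub>R w) \<longlongrightarrow> 0) (at_right (0::real))"
    by (auto intro!: tendsto_eq_intros)
  ultimately have "\<forall>\<^sub>F l in at_right (0::real). - 1 < ?H (l *\<^sub>R w)"
    by (rule eventually_compose_filterlim)
  with eventually_at_right_less[of 0] have "\<forall>\<^sub>F l in at_right (0::real). False"
    by eventually_elim (simp add: epi_liminf_blowup_scale w)
  then show False by simp
qed

text \<open>The difference quotient of the \<open>c\<close>-th power of \<open>max (f y - f x) 0\<close> is the image of the blow-up
under an increasing continuous function, and such functions commute with the limit inferior.\<close>

lemma subderivative_pos_powr:
  fixes f :: "'a::real_normed_vector \<Rightarrow> ereal"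
  assumes fin: "finite_at f x" and c: "c > 0"
  shows "subderivative (\<lambda>y. epowr (max (f y - f x) 0) c) x w
    = epowr (max (epi_liminf (blowup f x (1 / c)) w) 0) c"
proof -
  let ?F = "at_right (0::real) \<times>\<^sub>F nhds w"
  have "\<forall>\<^sub>F z in ?F. fst z > 0 \<and> True"
    by (rule eventually_prodI) (auto simp: eventually_at_right_less)
  then have "\<forall>\<^sub>F z in ?F. (case z of (t, w') \<Rightarrow>
      (epowr (max (f (x + t *\<^sub>R w') - f x) 0) c - epowr (max (f x - f x) 0) c) / ereal t)
      = epowr (max (case z of (t, w') \<Rightarrow> blowup f x (1 / c) t w') 0) c"
  proof eventually_elim
    case (elim z)
    obtain t y where z: "z = (t, y)" by fastforce
    have t: "t > 0" using elim by (simp add: z)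
    have x0: "epowr (max (f x - f x) 0) c = 0"
      using fin by (cases "f x") (auto simp: finite_at_def epowr_def)
    have "epowr (max d 0) c / ereal t = epowr (max (d / ereal (t powr (1 / c))) 0) c" for d
    proof (cases d)
      case (real r)
      have "max (r / t powr (1 / c)) 0 = max r 0 / t powr (1 / c)"
        using t by (auto simp: max_def field_simps)
      then show ?thesis using t c real by (simp add: epowr_max_ereal powr_divide powr_powr)
    qed (use t c in \<open>auto simp: epowr_def max_def\<close>)
    then show ?case unfolding z prod.case x0 blowup_def by simp
  qed
  then have "subderivative (\<lambda>y. epowr (max (f y - f x) 0) c) x w
      = Liminf ?F (\<lambda>z. epowr (max (case z of (t, w') \<Rightarrow> blowup f x (1 / c) t w') 0) c)"
    unfolding subderivative_def by (rule Liminf_eq)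
  also have "\<dots> = epowr (max (epi_liminf (blowup f x (1 / c)) w) 0) c"
    unfolding epi_liminf_def
    by (rule Liminf_compose_continuous_mono[OF continuous_on_pos_powr[OF c] mono_pos_powr[OF c]
          at_right_prod_nhds_neq_bot])
  finally show ?thesis .
qed

text \<open>The approximation of subgradients of the lower epi-limit, expressed through \<open>f\<close> itself. Undoing
the blow-up multiplies subgradients by \<open>t powr p / t\<close>.\<close>

lemma blowup_subgradient_sequence:
  fixes f :: "'a::euclidean_space \<Rightarrow> ereal"
  assumes fin: "f x = ereal c" and lsc: "locally_lsc_at f x" and p: "p > 0"
    and v: "v \<in> limiting_subdiff (epi_liminf (blowup f x p)) w"
    and a: "epi_liminf (blowup f x p) w = ereal a"
  obtains ts xs as vs where "\<And>k. 0 < ts k" "ts \<longlonglongrightarrow> 0" "xs \<longlonglongrightarrow> x" "as \<longlonglongrightarrow> a" "vs \<longlonglongrightarrow> v"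
    "\<And>k. f (xs k) = ereal (c + ts k powr p * as k)"
    "\<And>k. (ts k powr (p - 1)) *\<^sub>R vs k \<in> frechet_subdiff f (xs k)"
proof -
  have "finite_at f x" using fin by (simp add: finite_at_def)
  from limiting_subdiff_epi_liminf_approx[OF eventually_closed_epi_blowup[OF this lsc p] v a]
  obtain ts ws as vs where ts: "\<And>k. 0 < ts k" "ts \<longlonglongrightarrow> 0" and ws: "ws \<longlonglongrightarrow> w" and as: "as \<longlonglongrightarrow> a"
    and vs: "vs \<longlonglongrightarrow> v" and val: "\<And>k. blowup f x p (ts k) (ws k) = ereal (as k)"
    and sub: "\<And>k. vs k \<in> frechet_subdiff (blowup f x p (ts k)) (ws k)"
    by blast
  define xs where "xs k = x + ts k *\<^sub>R ws k" for k
  have "xs \<longlonglongrightarrow> x + 0 *\<^sub>R w" unfolding xs_def by (intro tendsto_intros ts ws)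
  then have 1: "xs \<longlonglongrightarrow> x" by simp
  have 2: "f (xs k) = ereal (c + ts k powr p * as k)" for k
    using val[of k] ts(1)[of k]
    by (cases "f (xs k)") (auto simp: blowup_def fin field_simps xs_def[symmetric] split: if_splits)
  have 3: "(ts k powr (p - 1)) *\<^sub>R vs k \<in> frechet_subdiff f (xs k)" for k
  proof -
    have "(ts k powr p / ts k) *\<^sub>R vs k \<in> frechet_subdiff f (xs k)"
      unfolding xs_def
      by (rule frechet_subdiff_rescale[of _ _ _ _ c])
        (use sub[of k] ts(1)[of k] in \<open>auto simp: blowup_def[abs_def] fin\<close>)
    then show ?thesis using ts(1)[of k] by (simp add: powr_diff)
  qed
  from that[OF ts 1 as vs 2 3] show thesis .
qed

text \<open>At the points \<open>xs k\<close> of the approximating sequence, the chain rule contributes the factor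
\<open>c * (ts k powr (1 / c) * as k) powr (c - 1)\<close> to a subgradient \<open>ts k powr (1 / c - 1) *\<^sub>R vs k\<close>. The exponent
\<open>1 / c\<close> of the blow-up is the one for which the powers of \<open>ts k\<close> cancel.\<close>

lemma blowup_subgradient_outer:
  fixes f :: "'a::euclidean_space \<Rightarrow> ereal"
  assumes fin: "finite_at f x" and lsc: "locally_lsc_at f x" and c: "c > 0"
    and v: "v \<in> limiting_subdiff (epi_liminf (blowup f x (1 / c))) w"
    and a: "epi_liminf (blowup f x (1 / c)) w = ereal a" "a > 0"
  shows "(c * a powr (c - 1)) *\<^sub>R v \<in> outer_limiting_subdiff (\<lambda>y. epowr (max (f y - f x) 0) c) x"
    (is "_ \<in> outer_limiting_subdiff ?g x")
proof -
  obtain b where b: "f x = ereal b" using fin by (cases "f x") (auto simp: finite_at_def)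
  have c': "1 / c > 0" using c by simp
  obtain ts xs as vs where ts: "\<And>k. 0 < ts k" "ts \<longlonglongrightarrow> 0" and xs: "xs \<longlonglongrightarrow> x" and as: "as \<longlonglongrightarrow> a"
    and vs: "vs \<longlonglongrightarrow> v" and val: "\<And>k. f (xs k) = ereal (b + ts k powr (1 / c) * as k)"
    and sub: "\<And>k. (ts k powr (1 / c - 1)) *\<^sub>R vs k \<in> frechet_subdiff f (xs k)"
    using blowup_subgradient_sequence[OF b lsc c' v a(1)] by blast
  have pos: "\<forall>\<^sub>F k in sequentially. as k > 0" using as a(2) by (rule order_tendstoD)
  have gx: "?g x = 0" by (simp add: b epowr_def)
  have gval: "?g (xs k) = ereal (ts k * as k powr c)" if "as k > 0" for k
  proof -
    have "ts k powr (1 / c) * as k > 0" using that ts(1)[of k] by simp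
    then show ?thesis using that ts(1)[of k] c by (simp add: val b epowr_ereal powr_mult powr_powr)
  qed
  show ?thesis
  proof (rule outer_limiting_subdiffI)
    show "finite_at ?g x" unfolding finite_at_def gx by simp
    show "xs \<longlonglongrightarrow> x" by fact
    show "(\<lambda>k. (c * as k powr (c - 1)) *\<^sub>R vs k) \<longlonglongrightarrow> (c * a powr (c - 1)) *\<^sub>R v"
      using as vs a(2) by (auto intro!: tendsto_intros)
    have "(\<lambda>k. ts k * as k powr c) \<longlonglongrightarrow> 0 * a powr c"
      using ts as a(2) by (intro tendsto_intros) auto
    then have "(\<lambda>k. ereal (ts k * as k powr c)) \<longlonglongrightarrow> ?g x" unfolding gx by (simp add: zero_ereal_def)
    then show "(\<lambda>k. ?g (xs k)) \<longlonglongrightarrow> ?g x"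
      by (rule Lim_transform_eventually) (use pos in eventually_elim, simp only: gval)
    show "\<forall>\<^sub>F k in sequentially. ?g x < ?g (xs k) \<and> (c * as k powr (c - 1)) *\<^sub>R vs k \<in> limiting_subdiff ?g (xs k)"
      using pos
    proof eventually_elim
      case (elim k)
      \<comment> \<open>The amount by which \<open>f (xs k)\<close> exceeds \<open>f x\<close>.\<close>
      define d where "d = ts k powr (1 / c) * as k"
      have d: "d > 0" using elim ts(1)[of k] by (simp add: d_def)
      have "\<forall>\<^sub>F \<beta> in nhds (b + d). \<beta> > b"
        using d by (intro order_tendstoD[OF filterlim_ident]) auto
      then have P: "\<forall>\<^sub>F \<beta> in nhds (b + d). epowr (max (ereal \<beta> - ereal b) 0) c = ereal ((\<beta> - b) powr c)"
        by eventually_elim (simp add: epowr_def max_def)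
      have D: "((\<lambda>\<beta>. (\<beta> - b) powr c) has_real_derivative c * d powr (c - 1)) (at (b + d))"
        using d by (auto intro!: derivative_eq_intros)
      have "mono (\<lambda>\<beta>. epowr (max (\<beta> - ereal b) 0) c)"
        by (rule monoI, rule monoD[OF mono_pos_powr[OF c]], rule ereal_minus_mono) auto
      from frechet_subdiff_mono_comp[OF sub[of k], of "b + d", OF _ this P D, of ?g]
      have "(c * d powr (c - 1)) *\<^sub>R (ts k powr (1 / c - 1)) *\<^sub>R vs k \<in> frechet_subdiff ?g (xs k)"
        by (simp add: val b d_def)
      moreover have "d powr (c - 1) = ts k powr (1 - 1 / c) * as k powr (c - 1)"
        using ts(1)[of k] elim c by (simp add: d_def powr_mult powr_powr diff_divide_distrib)
      then have "d powr (c - 1) * ts k powr (1 / c - 1) = as k powr (c - 1)"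
        using ts(1)[of k] by (simp add: powr_add[symmetric] mult_ac flip: mult.assoc)
      then have "(c * d powr (c - 1)) *\<^sub>R (ts k powr (1 / c - 1)) *\<^sub>R vs k = (c * as k powr (c - 1)) *\<^sub>R vs k"
        by (simp add: mult.assoc)
      ultimately have "(c * as k powr (c - 1)) *\<^sub>R vs k \<in> frechet_subdiff ?g (xs k)" by (simp only:)
      moreover have "?g x < ?g (xs k)" unfolding gx gval[OF elim] using ts(1)[of k] elim by simp
      ultimately show ?case using frechet_subdiff_subset_limiting by blast
    qed
  qed
qed

section \<open>The KL property\<close>

text \<open>Insert the approximating sequence into the KL inequality. Dividing by \<open>ts k powr (p * \<theta>)\<close> leaves
\<open>ts k powr (p - 1 - p * \<theta>)\<close> in front of the norm of the subgradient, which is \<open>1\<close> or tends to \<open>0\<close> according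
to whether the exponent vanishes. With a bound of \<open>0\<close> the inequality is contradictory: this is how too
small a KL exponent is excluded.\<close>

lemma KL_property_blowup_bound:
  fixes f :: "'a::euclidean_space \<Rightarrow> ereal"
  assumes KL: "KL_property f x \<theta> \<mu>" and p: "p > 0" and e: "0 \<le> p - 1 - p * \<theta>"
    and v: "v \<in> limiting_subdiff (epi_liminf (blowup f x p)) w"
    and a: "epi_liminf (blowup f x p) w = ereal a" "a > 0"
  shows "\<mu> / (1 - \<theta>) * a powr \<theta> \<le> (if p - 1 - p * \<theta> = 0 then norm v else 0)"
proof -
  define e where "e = p - 1 - p * \<theta>"
  obtain b where b: "f x = ereal b"
    using KL by (cases "f x") (auto simp: finite_at_def KL_property_def)
  obtain \<epsilon> \<nu> where \<epsilon>: "\<epsilon> > 0" and \<nu>: "\<nu> > 0" and KLx: "\<And>y. norm (y - x) \<le> \<epsilon> \<Longrightarrow> f y < f x + \<nu> \<Longrightarrow>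
      ereal (\<mu> / (1 - \<theta>)) * epowr (max (f y - f x) 0) \<theta> \<le> edist_set 0 (limiting_subdiff f y)"
    and lsc: "locally_lsc_at f x"
    using KL unfolding KL_property_def by blast
  obtain ts xs as vs where ts: "\<And>k. 0 < ts k" "ts \<longlonglongrightarrow> 0" and xs: "xs \<longlonglongrightarrow> x" and as: "as \<longlonglongrightarrow> a"
    and vs: "vs \<longlonglongrightarrow> v" and val: "\<And>k. f (xs k) = ereal (b + ts k powr p * as k)"
    and sub: "\<And>k. (ts k powr (p - 1)) *\<^sub>R vs k \<in> frechet_subdiff f (xs k)"
    using blowup_subgradient_sequence[OF b lsc p v a(1)] by blast
  have pow0: "(\<lambda>k. ts k powr r) \<longlonglongrightarrow> 0" if "r > 0" for r
  proof -
    have "(\<lambda>k. ts k powr r) \<longlonglongrightarrow> 0 powr r"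
      using that ts by (intro tendsto_powr') (auto intro!: always_eventually less_imp_le)
    then show ?thesis by simp
  qed
  have ev1: "\<forall>\<^sub>F k in sequentially. as k > 0" using as a(2) by (rule order_tendstoD)
  have "(\<lambda>k. norm (xs k - x)) \<longlonglongrightarrow> 0" using xs by (simp add: LIM_zero tendsto_norm_zero)
  then have ev2: "\<forall>\<^sub>F k in sequentially. norm (xs k - x) < \<epsilon>" using \<epsilon> by (rule order_tendstoD)
  have "(\<lambda>k. b + ts k powr p * as k) \<longlonglongrightarrow> b + 0 * a" by (intro tendsto_intros pow0 p as)
  then have "(\<lambda>k. f (xs k)) \<longlonglongrightarrow> f x" by (simp add: val b)
  moreover have "f x < f x + \<nu>" using \<nu> by (cases \<nu>) (auto simp: b)
  ultimately have ev3: "\<forall>\<^sub>F k in sequentially. f (xs k) < f x + \<nu>" by (rule order_tendstoD)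
  have ineq: "\<forall>\<^sub>F k in sequentially. \<mu> / (1 - \<theta>) * as k powr \<theta> \<le> ts k powr e * norm (vs k)"
    using ev1 ev2 ev3
  proof eventually_elim
    case (elim k)
    define s where "s = ts k powr p * as k"
    have s: "s > 0" using elim ts(1)[of k] by (simp add: s_def)
    have "ereal (\<mu> / (1 - \<theta>)) * epowr (max (f (xs k) - f x) 0) \<theta> \<le> edist_set 0 (limiting_subdiff f (xs k))"
      using elim by (intro KLx) auto
    also have "\<dots> \<le> ereal (norm ((ts k powr (p - 1)) *\<^sub>R vs k - 0))"
      unfolding edist_set_def using sub[of k] frechet_subdiff_subset_limiting by (intro INF_lower) blast
    finally have "\<mu> / (1 - \<theta>) * s powr \<theta> \<le> ts k powr (p - 1) * norm (vs k)"
      using s by (simp add: val b epowr_def max_def s_def[symmetric])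
    also have "s powr \<theta> = ts k powr (p * \<theta>) * as k powr \<theta>"
      using elim ts(1)[of k] by (simp add: s_def powr_mult powr_powr)
    also have "ts k powr (p - 1) = ts k powr (p * \<theta>) * ts k powr e"
      using ts(1)[of k] by (simp add: powr_add[symmetric] e_def)
    finally have "ts k powr (p * \<theta>) * (\<mu> / (1 - \<theta>) * as k powr \<theta>)
        \<le> ts k powr (p * \<theta>) * (ts k powr e * norm (vs k))" by (simp add: mult_ac)
    then show ?case by (rule mult_left_le_imp_le) (use ts(1)[of k] in simp)
  qed
  have L: "(\<lambda>k. \<mu> / (1 - \<theta>) * as k powr \<theta>) \<longlonglongrightarrow> \<mu> / (1 - \<theta>) * a powr \<theta>"
    using as a(2) by (intro tendsto_intros) auto
  have R: "(\<lambda>k. ts k powr e * norm (vs k)) \<longlonglongrightarrow> (if e = 0 then norm v else 0)"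
  proof (cases "e = 0")
    case True
    moreover have "(\<lambda>k. norm (vs k)) \<longlonglongrightarrow> norm v" using vs by (rule tendsto_norm)
    moreover have "ts k powr 0 = 1" for k using ts(1)[of k] by simp
    ultimately show ?thesis by simp
  next
    case False
    then have "e > 0" using e by (simp add: e_def)
    have "(\<lambda>k. ts k powr e * norm (vs k)) \<longlonglongrightarrow> 0 * norm v"
      by (intro tendsto_intros pow0 \<open>e > 0\<close> vs)
    then show ?thesis using False by simp
  qed
  show ?thesis using tendsto_le[OF sequentially_bot R L ineq] by (simp add: e_def)
qed

lemma lsc_imp_locally_lsc_at:
  fixes \<phi> :: "'a::first_countable_topology \<Rightarrow> ereal"
  shows "lsc \<phi> \<Longrightarrow> locally_lsc_at \<phi> x"
  unfolding locally_lsc_at_def locally_closed_at_def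
  by (rule exI[of _ UNIV]) (simp add: lsc_closed_epi)

lemma lsc_max_0:
  fixes \<phi> :: "'a::topological_space \<Rightarrow> ereal"
  assumes "lsc \<phi>" shows "lsc (\<lambda>w. max (\<phi> w) 0)"
  unfolding lsc_def
proof
  fix x
  have "\<phi> x \<le> Liminf (nhds x) \<phi>" using assms by (simp add: lsc_def)
  also have "\<dots> \<le> Liminf (nhds x) (\<lambda>w. max (\<phi> w) 0)" by (rule Liminf_mono) simp
  finally show "max (\<phi> x) 0 \<le> Liminf (nhds x) (\<lambda>w. max (\<phi> w) 0)"
    by (auto intro: Liminf_bounded)
qed

text \<open>Points where \<open>\<psi>\<close> is not positive satisfy the KL inequality trivially, because \<open>0 powr \<theta> = 0\<close> also
for \<open>\<theta> = 0\<close>; the bound at the remaining points of finite value is a global KL inequality, that is, one with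
\<open>\<nu> = \<infinity>\<close> and an arbitrary radius.\<close>

lemma KL_property_0I:
  fixes \<psi> :: "'a::euclidean_space \<Rightarrow> ereal"
  assumes "lsc \<psi>" "\<psi> 0 = 0" "0 \<le> \<theta>" "\<theta> < 1" "0 < \<mu>"
    and bound: "\<And>w. 0 < \<psi> w \<Longrightarrow> \<psi> w < \<infinity> \<Longrightarrow>
      ereal (\<mu> / (1 - \<theta>)) * epowr (\<psi> w) \<theta> \<le> edist_set 0 (limiting_subdiff \<psi> w)"
  shows "KL_property \<psi> 0 \<theta> \<mu>"
proof -
  have "ereal (\<mu> / (1 - \<theta>)) * epowr (max (\<psi> w - \<psi> 0) 0) \<theta> \<le> edist_set 0 (limiting_subdiff \<psi> w)"
    if "\<psi> w < \<infinity>" for w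
  proof (cases "0 < \<psi> w")
    case True
    then show ?thesis using bound[OF True that] by (simp add: assms(2) max_absorb1[OF less_imp_le[OF True]])
  next
    case False
    then have "max (\<psi> w - \<psi> 0) 0 = 0" by (simp add: assms(2) max_absorb2)
    then show ?thesis by (auto simp: epowr_def edist_set_def intro!: INF_greatest)
  qed
  then show ?thesis unfolding KL_property_def
    using assms(1-5) lsc_imp_locally_lsc_at[of \<psi> 0]
    by (auto simp: finite_at_def intro!: exI[of _ "1::real"] exI[of _ "\<infinity>::ereal"])
qed

theorem theorem3p4:
  fixes f g h h_plus :: "real ^ 'n \<Rightarrow> ereal"
    and xbar :: "real ^ 'n"
    and \<theta> :: real
    and W U :: "(real ^ 'n) set"
  assumes f_finite: "finite_at f xbar"
    and f_lsc: "locally_lsc_at f xbar"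
    and theta: "0 \<le> \<theta>" "\<theta> < 1"
    and g_def: "g = (\<lambda>x. epowr (max (f x - f xbar) 0) (1 - \<theta>))"
    and h_def: "h = (\<lambda>w. Liminf (at_right (0::real) \<times>\<^sub>F nhds w)
       (\<lambda>(\<tau>, w'). (f (xbar + \<tau> *\<^sub>R w') - f xbar) / ereal ((1 - \<theta>) * \<tau> powr (1 / (1 - \<theta>)))))"
    and W_def: "W = {w. 0 < h w \<and> h w < \<infinity>}"
    and h_plus_def: "h_plus = (\<lambda>w. max (h w) 0)"
    and U_def: "U = (\<Union>w\<in>W.
       (\<lambda>v. ((1 - \<theta>) / ((1 - \<theta>) * real_of_ereal (h w)) powr \<theta>) *\<^sub>R v) `
         limiting_subdiff (\<lambda>u. ereal (1 - \<theta>) * h u) w)"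
  shows
    "(lsc h \<and> pos_homogeneous (1 / (1 - \<theta>)) h \<and>
      (\<forall>w. \<forall>v \<in> limiting_subdiff (\<lambda>u. ereal (1 - \<theta>) * h u) w. h w = ereal (v \<bullet> w)) \<and>
      (h 0 = 0 \<or> h 0 = -\<infinity>) \<and> (proper_fun h \<longleftrightarrow> h 0 = 0))
     \<and>
     (U \<subseteq> outer_limiting_subdiff g xbar \<and> (\<forall>v\<in>U. v \<noteq> 0) \<and> (U \<noteq> {} \<longleftrightarrow> W \<noteq> {}) \<and>
      outer_limiting_subdiff (subderivative g xbar) 0 = closure U)
     \<and>
     (W \<noteq> {} \<longrightarrow> (\<forall>\<theta>'. 0 \<le> \<theta>' \<and> \<theta>' < \<theta> \<longrightarrow> \<not> KL_exponent f xbar \<theta>'))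
     \<and>
     (\<forall>\<mu>>0. KL_property f xbar \<theta> \<mu> \<longrightarrow>
        (\<forall>w\<in>W. edist_set 0 (limiting_subdiff (\<lambda>u. ereal (1 - \<theta>) * h u) w) \<ge>
           ereal (\<mu> / (1 - \<theta>)) * epowr (ereal (1 - \<theta>) * h w) \<theta>))
     \<and>
     ((proper_fun h \<longrightarrow>
         KL_modulus f xbar \<theta> \<le> KL_modulus (\<lambda>w. ereal (1 - \<theta>) * h w) 0 \<theta>) \<and>
      (\<not> proper_fun h \<longrightarrow>
         KL_modulus f xbar \<theta> \<le> KL_modulus (\<lambda>w. ereal (1 - \<theta>) * h_plus w) 0 \<theta>))"
proof -
  define c where "c = 1 - \<theta>"
  have c: "0 < c" "c \<le> 1" and c\<theta>: "1 - \<theta> = c" "\<theta> = 1 - c" using theta by (auto simp: c_def)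
  have p: "1 / c > 0" using c by simp
  define H where "H = epi_liminf (blowup f xbar (1 / c))"
  have H_lsc: "lsc H" unfolding H_def by (rule lsc_epi_liminf)
  have H_hom: "H (l *\<^sub>R w) = ereal (l powr (1 / c)) * H w" if "l > 0" for l w
    unfolding H_def using that by (rule epi_liminf_blowup_scale)
  have H0: "H 0 = 0 \<or> H 0 = -\<infinity>" unfolding H_def by (rule epi_liminf_blowup_0[OF f_finite p])
  have h_H: "h w = ereal (1 / c) * H w" for w
  proof -
    have "H w * ereal (1 / c) = Liminf (at_right (0::real) \<times>\<^sub>F nhds w)
        (\<lambda>z. (case z of (t, w') \<Rightarrow> blowup f xbar (1 / c) t w') * ereal (1 / c))"
      unfolding H_def epi_liminf_def using p
      by (intro Liminf_ereal_mult_right[symmetric]) (auto simp: at_right_prod_nhds_neq_bot)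
    also have "\<dots> = h w" unfolding h_def c\<theta>(1)
    proof (rule Liminf_eq)
      have "\<forall>\<^sub>F z in at_right (0::real) \<times>\<^sub>F nhds w. fst z > 0 \<and> True"
        by (rule eventually_prodI) (auto simp: eventually_at_right_less)
      then show "\<forall>\<^sub>F z in at_right 0 \<times>\<^sub>F nhds w.
          (case z of (t, w') \<Rightarrow> blowup f xbar (1 / c) t w') * ereal (1 / c)
          = (case z of (t, w') \<Rightarrow> (f (xbar + t *\<^sub>R w') - f xbar) / ereal (c * t powr (1 / c)))"
      proof eventually_elim
        case (elim z)
        then show ?case using c
          by (cases z; cases "f (xbar + fst z *\<^sub>R snd z) - f xbar") (auto simp: blowup_def)
      qed
    qed
    finally show ?thesis by (simp add: mult.commute)
  qed
  have H_h: "ereal c * h w = H w" for w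
    using c by (cases "H w") (auto simp: h_H)
  have H_h_fun: "(\<lambda>w. ereal c * h w) = H" using H_h by (rule ext)
  have W_H: "w \<in> W \<longleftrightarrow> 0 < H w \<and> H w < \<infinity>" for w
    using c by (cases "H w") (auto simp: W_def h_H zero_less_divide_iff)
  have W_real: "\<exists>a. H w = ereal a \<and> a > 0" if "w \<in> W" for w
    using that unfolding W_H by (cases "H w") auto
  have euler: "h w = ereal (v \<bullet> w)" if v: "v \<in> limiting_subdiff H w" for v w
  proof -
    obtain a where a: "H w = ereal a" using v by (rule limiting_subdiff_finite)
    show ?thesis using limiting_subdiff_euler[OF v a H_hom] by (simp add: h_H a)
  qed

  \<comment> \<open>The factor that the chain rule attaches to the power \<open>c\<close> at the value \<open>a\<close>; with
    \<open>a = H w\<close> it is the coefficient in the definition of \<open>U\<close>.\<close>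
  define scale where "scale a = c * a powr (c - 1)" for a
  have U_eq: "U = (\<Union>w\<in>W. (\<lambda>v. scale (real_of_ereal (H w)) *\<^sub>R v) ` limiting_subdiff H w)"
  proof -
    have "c / (c * real_of_ereal (h w)) powr \<theta> = scale (real_of_ereal (H w))" if "w \<in> W" for w
    proof -
      have "c * real_of_ereal (h w) = real_of_ereal (H w)" using c by (simp add: h_H)
      moreover have "\<theta> = - (c - 1)" by (simp add: c_def)
      ultimately show ?thesis by (simp only: scale_def powr_minus divide_inverse inverse_inverse_eq)
    qed
    then show ?thesis unfolding U_def c\<theta>(1) H_h_fun by auto
  qed
  define G where "G w = epowr (max (H w) 0) c" for w
  have dg: "subderivative g xbar = G"
    unfolding g_def G_def[abs_def] H_def c\<theta>(1) by (rule ext, rule subderivative_pos_powr[OF f_finite c(1)])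
  have W_G: "{w. 0 < G w \<and> G w < \<infinity>} = W"
  proof -
    have "0 < G w \<and> G w < \<infinity> \<longleftrightarrow> 0 < H w \<and> H w < \<infinity>" for w
      using c by (cases "H w") (auto simp: G_def epowr_def max_def)
    then show ?thesis using W_H by auto
  qed
  have G_sub: "limiting_subdiff G w = (\<lambda>v. scale (real_of_ereal (H w)) *\<^sub>R v) ` limiting_subdiff H w"
    if w: "w \<in> W" for w
  proof -
    obtain a where a: "H w = ereal a" "a > 0" using W_real[OF w] by blast
    show ?thesis using limiting_subdiff_pos_powr_eq[OF H_lsc a c(1)]
      by (simp add: G_def[abs_def] a scale_def)
  qed
  have G_hom: "G (l *\<^sub>R w) = ereal l * G w" if l: "l > 0" for l w
  proof (cases "H w")
    case (real a)
    have "max (l powr (1 / c) * a) 0 = l powr (1 / c) * max a 0"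
      by (simp add: max_mult_distrib_left)
    then show ?thesis using l c by (simp add: G_def H_hom real epowr_max_ereal powr_mult powr_powr)
  qed (use l c in \<open>auto simp: G_def H_hom epowr_def max_def\<close>)
  have G0: "G 0 = 0" using H0 by (auto simp: G_def epowr_def)

  have a: "lsc h \<and> pos_homogeneous (1 / (1 - \<theta>)) h \<and>
      (\<forall>w. \<forall>v \<in> limiting_subdiff (\<lambda>u. ereal (1 - \<theta>) * h u) w. h w = ereal (v \<bullet> w)) \<and>
      (h 0 = 0 \<or> h 0 = -\<infinity>) \<and> (proper_fun h \<longleftrightarrow> h 0 = 0)"
  proof (intro conjI)
    show "lsc h"
      using lsc_epi_liminf[of "\<lambda>\<tau> w'. (f (xbar + \<tau> *\<^sub>R w') - f xbar) / ereal ((1 - \<theta>) * \<tau> powr (1 / (1 - \<theta>)))"]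
      by (simp add: h_def epi_liminf_def[abs_def])
    show "pos_homogeneous (1 / (1 - \<theta>)) h"
      unfolding pos_homogeneous_def c\<theta>(1) by (simp add: h_H H_hom mult_ac)
    show "\<forall>w. \<forall>v \<in> limiting_subdiff (\<lambda>u. ereal (1 - \<theta>) * h u) w. h w = ereal (v \<bullet> w)"
      unfolding c\<theta>(1) H_h_fun using euler by blast
    show h0: "h 0 = 0 \<or> h 0 = -\<infinity>" using H0 c by (auto simp: h_H)
    have "h w \<noteq> -\<infinity>" if "h 0 = 0" for w
    proof -
      have "H 0 = 0" using that H0 c by (auto simp: h_H)
      then have "H w \<noteq> -\<infinity>" unfolding H_def by (rule epi_liminf_blowup_neq_MInfty)
      then show ?thesis using c by (cases "H w") (auto simp: h_H)
    qed
    then show "proper_fun h \<longleftrightarrow> h 0 = 0" unfolding proper_fun_def using h0 by (metis PInfty_neq_ereal(1) zero_ereal_def)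
  qed

  have b: "U \<subseteq> outer_limiting_subdiff g xbar \<and> (\<forall>v\<in>U. v \<noteq> 0) \<and> (U \<noteq> {} \<longleftrightarrow> W \<noteq> {}) \<and>
      outer_limiting_subdiff (subderivative g xbar) 0 = closure U"
  proof (intro conjI)
    show "U \<subseteq> outer_limiting_subdiff g xbar"
    proof
      fix u assume "u \<in> U"
      then obtain w v where w: "w \<in> W" "v \<in> limiting_subdiff H w" "u = scale (real_of_ereal (H w)) *\<^sub>R v"
        unfolding U_eq by blast
      obtain a where a: "H w = ereal a" "a > 0" using W_real[OF w(1)] by blast
      show "u \<in> outer_limiting_subdiff g xbar"
        using blowup_subgradient_outer[OF f_finite f_lsc c(1) w(2)[unfolded H_def] a[unfolded H_def]]
        by (simp add: w(3) a scale_def g_def c\<theta>(1))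
    qed
    show "\<forall>v\<in>U. v \<noteq> 0"
    proof
      fix u assume "u \<in> U"
      then obtain w v where w: "w \<in> W" "v \<in> limiting_subdiff H w" "u = scale (real_of_ereal (H w)) *\<^sub>R v"
        unfolding U_eq by blast
      obtain a where a: "H w = ereal a" "a > 0" using W_real[OF w(1)] by blast
      have "v \<noteq> 0" using euler[OF w(2)] w(1) by (auto simp: W_def)
      moreover have "scale a > 0" using a c by (simp add: scale_def)
      ultimately show "u \<noteq> 0" by (simp add: w(3) a)
    qed
    have "\<exists>w\<in>W. limiting_subdiff H w \<noteq> {}" if W: "W \<noteq> {}"
    proof -
      obtain w where "w \<in> W" using W by blast
      then obtain a where a: "H w = ereal a" "a > 0" using W_real by blast
      obtain w' a' v where "H w' = ereal a'" "0 < a'" "v \<in> frechet_subdiff H w'"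
        using lsc_ex_frechet_subgradient[OF H_lsc a] by metis
      then show ?thesis using frechet_subdiff_subset_limiting W_H by fastforce
    qed
    then show "U \<noteq> {} \<longleftrightarrow> W \<noteq> {}" unfolding U_eq by blast
    have "outer_limiting_subdiff G 0 = closure (\<Union>w\<in>W. limiting_subdiff G w)"
      using outer_limiting_subdiff_homogeneous[of G, OF G_hom G0] unfolding W_G .
    then show "outer_limiting_subdiff (subderivative g xbar) 0 = closure U"
      unfolding dg U_eq using G_sub by simp
  qed

  \<comment> \<open>The exponent of \<open>t\<close> that the KL inequality leaves behind is \<open>(\<theta> - \<theta>') / c\<close>.\<close>
  have exponent: "0 \<le> 1 / c - 1 - 1 / c * \<theta>'" "1 / c - 1 - 1 / c * \<theta>' = 0 \<longleftrightarrow> \<theta>' = \<theta>"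
    if "\<theta>' \<le> \<theta>" for \<theta>'
  proof -
    have "1 / c - 1 - 1 / c * \<theta>' = (\<theta> - \<theta>') / c"
      unfolding c\<theta>(2) using c by (simp add: diff_divide_distrib)
    then show "0 \<le> 1 / c - 1 - 1 / c * \<theta>'" "1 / c - 1 - 1 / c * \<theta>' = 0 \<longleftrightarrow> \<theta>' = \<theta>"
      using that c by auto
  qed

  have "\<not> KL_exponent f xbar \<theta>'" if W: "W \<noteq> {}" and \<theta>': "0 \<le> \<theta>'" "\<theta>' < \<theta>" for \<theta>'
  proof
    assume "KL_exponent f xbar \<theta>'"
    then obtain \<mu> where KL: "KL_property f xbar \<theta>' \<mu>" by (auto simp: KL_exponent_def)
    have "U \<noteq> {}" using b W by blast
    then obtain w v where w: "w \<in> W" "v \<in> limiting_subdiff H w" unfolding U_eq by blast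
    obtain a where a: "H w = ereal a" "a > 0" using W_real[OF w(1)] by blast
    have "\<mu> / (1 - \<theta>') * a powr \<theta>' \<le> 0"
      using KL_property_blowup_bound[OF KL p exponent(1) w(2)[unfolded H_def] a[unfolded H_def]]
        exponent(2) \<theta>' by simp
    moreover have "\<mu> / (1 - \<theta>') * a powr \<theta>' > 0"
      using KL a \<theta>' theta by (simp add: KL_property_def)
    ultimately show False by simp
  qed
  then have no_KL: "W \<noteq> {} \<longrightarrow> (\<forall>\<theta>'. 0 \<le> \<theta>' \<and> \<theta>' < \<theta> \<longrightarrow> \<not> KL_exponent f xbar \<theta>')" by blast

  have d: "ereal (\<mu> / (1 - \<theta>)) * epowr (H w) \<theta> \<le> edist_set 0 (limiting_subdiff H w)"
    if KL: "KL_property f xbar \<theta> \<mu>" and w: "w \<in> W" for \<mu> w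
    unfolding edist_set_def
  proof (rule INF_greatest)
    fix v assume v: "v \<in> limiting_subdiff H w"
    obtain a where a: "H w = ereal a" "a > 0" using W_real[OF w] by blast
    have "\<mu> / (1 - \<theta>) * a powr \<theta> \<le> norm v"
      using KL_property_blowup_bound[OF KL p exponent(1) v[unfolded H_def] a[unfolded H_def]]
        exponent(2) by simp
    then show "ereal (\<mu> / (1 - \<theta>)) * epowr (H w) \<theta> \<le> ereal (norm (v - 0))"
      by (simp add: a epowr_ereal)
  qed

  have KL_H: "KL_property H 0 \<theta> \<mu>" if "H 0 = 0" and KL: "KL_property f xbar \<theta> \<mu>" for \<mu>
    using that theta d[OF KL] W_H
    by (intro KL_property_0I H_lsc) (auto simp: KL_property_def)
  have KL_H_pos: "KL_property (\<lambda>w. max (H w) 0) 0 \<theta> \<mu>" if KL: "KL_property f xbar \<theta> \<mu>" for \<mu>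
  proof (rule KL_property_0I[OF lsc_max_0[OF H_lsc]])
    show "max (H 0) 0 = 0" using H0 by auto
    show "0 < \<mu>" using KL by (simp add: KL_property_def)
    fix w assume w: "0 < max (H w) 0" "max (H w) 0 < \<infinity>"
    then have Hw: "0 < H w" "H w < \<infinity>" by (auto simp: max_def split: if_splits)
    then have "ereal (\<mu> / (1 - \<theta>)) * epowr (H w) \<theta> \<le> edist_set 0 (limiting_subdiff H w)"
      using d[OF KL] W_H by blast
    also have "\<dots> \<le> edist_set 0 (limiting_subdiff (\<lambda>w. max (H w) 0) w)"
      unfolding edist_set_def using limiting_subdiff_pos_part[OF H_lsc Hw(1)]
      by (intro INF_superset_mono) auto
    finally show "ereal (\<mu> / (1 - \<theta>)) * epowr (max (H w) 0) \<theta>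
        \<le> edist_set 0 (limiting_subdiff (\<lambda>w. max (H w) 0) w)"
      using max_absorb1[OF less_imp_le[OF Hw(1)]] by simp
  qed (use theta in auto)

  have e1: "KL_modulus f xbar \<theta> \<le> KL_modulus (\<lambda>w. ereal (1 - \<theta>) * h w) 0 \<theta>" if "proper_fun h"
  proof -
    have "h 0 = 0" using a that by blast
    then have "H 0 = 0" using H_h[of 0] by simp
    then show ?thesis unfolding c\<theta>(1) H_h_fun KL_modulus_def
      using KL_H by (intro Sup_subset_mono) auto
  qed
  have e2: "KL_modulus f xbar \<theta> \<le> KL_modulus (\<lambda>w. ereal (1 - \<theta>) * h_plus w) 0 \<theta>"
  proof -
    have "ereal (1 - \<theta>) * h_plus w = max (H w) 0" for w
    proof (cases "H w")
      case (real r)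
      have "c * max (r / c) 0 = max r 0" using c by (simp add: max_mult_distrib_left)
      then show ?thesis
        by (simp add: c\<theta>(1) h_plus_def h_H real zero_ereal_def flip: ereal_max)
    qed (use c in \<open>auto simp: c\<theta>(1) h_plus_def h_H\<close>)
    then show ?thesis unfolding KL_modulus_def
      using KL_H_pos by (intro Sup_subset_mono) auto
  qed
  show ?thesis using a b no_KL d e1 e2 unfolding c\<theta>(1) H_h_fun by (simp add: H_h)
qed

end
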